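(* Let $V_1,V_2:[0,\infty)\to\mathbb{R}$ be functions that belong to $C^2((0,\infty))$, are continuous at $0$, and satisfy, for some $\varepsilon>0$ and all sufficiently large $z$, $$\frac{V_i(z)}{\log z}\ge 2+\varepsilon,\qquad i=1,2.$$ Assume that the functions on $(0,\infty)$ $$W_1(z):=V_1(z)-\log z,\qquad W_2(z):=V_2(z)-\log z$$ each have a unique minimizer $z_1^*\in(0,\infty)$ and $z_2^*\in(0,\infty)$, respectively. For each $n$ let $m^{(n)}=(m_1^{(n)},\dots,m_n^{(n)})$ be drawn from the probability measure $\mathbb{P}_{n,\mathbb{R}_+,V_{1,2}}$ on $\mathcal{M}_n(\mathbb{R}_+)$ (defined in the context), all random variables $m_j^{(n)}$ being defined on the same probability space. Then for any $k\ge1$, as $n\to\infty$, $$(m_1^{(n)},\dots,m_k^{(n)})\to(m_1^*,\dots,m_k^* )$$ almost surely and in $L^1$, where $m_1^*,\dots,m_k^*$ are the first $k$ moments of the Marchenko-Pastur distribution $$\mu_{MP,z_1^*,z_2^*}(dx)=\left(1-\frac{z_1^*}{z_2^*}\right)_+\delta_0+\frac{1}{2\pi z_2^*}\frac{\sqrt{(x-l_-)(l_+-x)}}{x}\,1_{[l_-,l_+]}(x)\,dx,\qquad l_\pm:=\left(\sqrt{z_1^*}\pm\sqrt{z_2^*}\right)^2,$$ that is, $$m_j^*=\sum_{i=0}^{\lfloor\frac{j-1}{2}\rfloor}\binom{j-1}{2i}(z_1^* )^{i+1}(z_2^* )^i(z_1^*+z_2^* )^{j-1-2i}\,\frac{1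}{i+1}\binom{2i}{i}.$$
   Context: Notation: $\mathbb{R}_+=[0,\infty)$; $(y)_+=\max(y,0)$; $\delta_y$ is the Dirac measure at $y$; $\lfloor x\rfloor$ is the largest integer not exceeding $x$. Moment space: let $\mathcal{P}(\mathbb{R}_+)$ be the set of Borel probability measures on $\mathbb{R}_+$ with finite moments of all orders, $m_j(\mu)=\int x^j\,d\mu(x)$, and $\mathcal{M}_n(\mathbb{R}_+)=\{(m_1(\mu),\dots,m_n(\mu)):\mu\in\mathcal{P}(\mathbb{R}_+)\}\subset\mathbb{R}^n$, with interior $\mathrm{Int}(\mathcal{M}_n(\mathbb{R}_+))$ and boundary $\partial\mathcal{M}_n(\mathbb{R}_+)$. Canonical moments: for $(m_1,\dots,m_n)\in\mathrm{Int}(\mathcal{M}_n(\mathbb{R}_+))$ and $1\le k\le n$, the set of possible values of the $k$-th moment of measures in $\mathcal{P}(\mathbb{R}_+)$ with first $k-1$ moments $m_1,\dots,m_{k-1}$ is an interval of the form $[m_k^-,\infty)$. With $m_0:=1$, $m_0^-:=0$, the canonical moments are $$z_k:=\frac{m_k-m_k^-}{m_{k-1}-m_{k-1}^-},\qquad k=1,\dots,n,$$ and $(z_1,\dots,z_n)\mapsto(m_1,\dots,m_n)$ is a bijection from $(0,\infty)^n$ onto $\mathrm{Int}(\mathcal{M}_n(\mathbb{R}_+))$. The measure $\mathbb{P}_{n,\mathbb{R}_+,V_{1,2}}$: the probability measure on $\mathcal{M}_n(\mathbb{R}_+)$ with $\mathbb{P}_{n,\mathbb{R}_+,V_{1,2}}(\partial\mathcal{M}_n(\mathbb{R}_+))=0$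 and, on $\mathrm{Int}(\mathcal{M}_n(\mathbb{R}_+))$, density with respect to $n$-dimensional Lebesgue measure $$\frac{1}{Z_{n,\mathbb{R}_+,V_{1,2}}}\exp\Big[-n\sum_{j=1}^{\lfloor\frac{n+1}{2}\rfloor}V_1(z_{2j-1})-n\sum_{j=1}^{\lfloor\frac n2\rfloor}V_2(z_{2j})\Big],$$ where $z_j$ are the canonical moments of $(m_1,\dots,m_n)$ and $Z_{n,\mathbb{R}_+,V_{1,2}}$ is the normalization constant. *)

theory Defs
  imports "HOL-Probability.Probability"
begin

section \<open>The moment space of the half line\<close>

definition moment :: "real measure \<Rightarrow> nat \<Rightarrow> real" where
  "moment \<mu> j = (\<integral>x. x ^ j \<partial>\<mu>)"

text \<open>Probability measures on the half line are represented as Borel probability measures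
  on the whole line under which the negative numbers are a null set.\<close>

definition half_line_measures :: "real measure set" where
  "half_line_measures =
    {\<mu>. prob_space \<mu> \<and> sets \<mu> = sets borel \<and> emeasure \<mu> {..<0} = 0 \<and>
        (\<forall>j. integrable \<mu> (\<lambda>x. x ^ j))}"

text \<open>Vectors with \<open>n\<close> coordinates are functions in the extensional product
  \<open>{1..n} \<rightarrow>\<^sub>E UNIV\<close>, so that \<open>n\<close> may vary; coordinates are counted from one.
  The topology on this carrier is \<^term>\<open>powertop_real {1..n}\<close>, and Lebesgue measure is the
  product \<^term>\<open>PiM {1..n} (\<lambda>_. lborel)\<close>.\<close>

definition moment_space :: "nat \<Rightarrow> (nat \<Rightarrow> real) set" where
  "moment_space n = {\<lambda>j\<in>{1..n}. moment \<mu> j | \<mu>. \<mu> \<in> half_line_measures}"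

definition moment_space_interior :: "nat \<Rightarrow> (nat \<Rightarrow> real) set" where
  "moment_space_interior n = powertop_real {1..n} interior_of moment_space n"

definition lebesgue_prod :: "nat \<Rightarrow> (nat \<Rightarrow> real) measure" where
  "lebesgue_prod n = PiM {1..n} (\<lambda>_. lborel)"


section \<open>Canonical moments\<close>

definition moment_range :: "(nat \<Rightarrow> real) \<Rightarrow> nat \<Rightarrow> real set" where
  "moment_range m k =
    {moment \<mu> k | \<mu>. \<mu> \<in> half_line_measures \<and> (\<forall>j\<in>{1..<k}. moment \<mu> j = m j)}"

text \<open>For \<open>m\<close> in the interior of the moment space, the range is a closed interval unbounded
  to the right; its left end point is its infimum.\<close>

definition lower_moment :: "(nat \<Rightarrow> real) \<Rightarrow> nat \<Rightarrow> real" where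
  "lower_moment m k = (if k = 0 then 0 else Inf (moment_range m k))"

definition moment_excess :: "(nat \<Rightarrow> real) \<Rightarrow> nat \<Rightarrow> real" where
  "moment_excess m k = (if k = 0 then 1 else m k) - lower_moment m k"

definition canonical_moment :: "(nat \<Rightarrow> real) \<Rightarrow> nat \<Rightarrow> real" where
  "canonical_moment m k = moment_excess m k / moment_excess m (k - 1)"


section \<open>The random moment vector\<close>

definition moment_weight ::
    "(real \<Rightarrow> real) \<Rightarrow> (real \<Rightarrow> real) \<Rightarrow> nat \<Rightarrow> (nat \<Rightarrow> real) \<Rightarrow> real" where
  "moment_weight V1 V2 n m = indicator (moment_space_interior n) m *
     exp (- real n * (\<Sum>j=1..(n + 1) div 2. V1 (canonical_moment m (2 * j - 1)))
          - real n * (\<Sum>j=1..n div 2. V2 (canonical_moment m (2 * j))))"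

definition moment_partition ::
    "(real \<Rightarrow> real) \<Rightarrow> (real \<Rightarrow> real) \<Rightarrow> nat \<Rightarrow> ennreal" where
  "moment_partition V1 V2 n = (\<integral>\<^sup>+m. ennreal (moment_weight V1 V2 n m) \<partial>lebesgue_prod n)"

text \<open>As a measure on the whole coordinate space; it gives no mass to the complement of the
  interior of the moment space, hence none to its boundary.\<close>

definition moment_law ::
    "(real \<Rightarrow> real) \<Rightarrow> (real \<Rightarrow> real) \<Rightarrow> nat \<Rightarrow> (nat \<Rightarrow> real) measure" where
  "moment_law V1 V2 n = density (lebesgue_prod n)
     (\<lambda>m. ennreal (moment_weight V1 V2 n m) / moment_partition V1 V2 n)"


section \<open>Assumptions on the potentials\<close>

definition C2_on :: "real set \<Rightarrow> (real \<Rightarrow> real) \<Rightarrow> bool" where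
  "C2_on S f \<longleftrightarrow> (\<exists>f' f''.
     (\<forall>x\<in>S. (f has_real_derivative f' x) (at x)) \<and>
     (\<forall>x\<in>S. (f' has_real_derivative f'' x) (at x)) \<and> continuous_on S f'')"

text \<open>Values of \<open>V\<close> at negative arguments play no role.\<close>

definition admissible_potential :: "real \<Rightarrow> (real \<Rightarrow> real) \<Rightarrow> bool" where
  "admissible_potential \<epsilon> V \<longleftrightarrow>
     C2_on {0<..} V \<and> continuous (at 0 within {0..}) V \<and>
     (\<forall>\<^sub>F z in at_top. V z / ln z \<ge> 2 + \<epsilon>)"

definition unique_minimizer_on :: "(real \<Rightarrow> real) \<Rightarrow> real set \<Rightarrow> real \<Rightarrow> bool" where
  "unique_minimizer_on f S x \<longleftrightarrow> (\<forall>z. is_arg_min f (\<lambda>y. y \<in> S) z \<longleftrightarrow> z = x)"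


section \<open>The Marchenko-Pastur distribution\<close>

definition mp_lower :: "real \<Rightarrow> real \<Rightarrow> real" where
  "mp_lower z1 z2 = (sqrt z1 - sqrt z2)\<^sup>2"

definition mp_upper :: "real \<Rightarrow> real \<Rightarrow> real" where
  "mp_upper z1 z2 = (sqrt z1 + sqrt z2)\<^sup>2"

definition mp_density :: "real \<Rightarrow> real \<Rightarrow> real \<Rightarrow> real" where
  "mp_density z1 z2 x =
     1 / (2 * pi * z2) * (sqrt ((x - mp_lower z1 z2) * (mp_upper z1 z2 - x)) / x) *
     indicator {mp_lower z1 z2..mp_upper z1 z2} x"

definition marchenko_pastur :: "real \<Rightarrow> real \<Rightarrow> real measure" where
  "marchenko_pastur z1 z2 = measure_of UNIV (sets borel)
     (\<lambda>A. ennreal (max (1 - z1 / z2) 0) * emeasure (return borel 0) A +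
          emeasure (density lborel (\<lambda>x. ennreal (mp_density z1 z2 x))) A)"

lemma sets_marchenko_pastur: "sets (marchenko_pastur z1 z2) = sets borel"
  unfolding marchenko_pastur_def
  by (metis sets.sigma_sets_eq sets_measure_of space_borel top_greatest Pow_UNIV)

text \<open>The set function in the definition is countably additive, so it is the measure:\<close>

lemma emeasure_marchenko_pastur:
  assumes "A \<in> sets borel"
  shows "emeasure (marchenko_pastur z1 z2) A =
    ennreal (max (1 - z1 / z2) 0) * emeasure (return borel 0) A +
    emeasure (density lborel (\<lambda>x. ennreal (mp_density z1 z2 x))) A"
proof (rule emeasure_measure_of[OF marchenko_pastur_def])
  let ?f = "\<lambda>A. ennreal (max (1 - z1 / z2) 0) * emeasure (return borel (0::real)) A"
  let ?g = "\<lambda>A. emeasure (density lborel (\<lambda>x. ennreal (mp_density z1 z2 x))) A"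
  show "sets (borel::real measure) \<subseteq> Pow UNIV" by simp
  show "A \<in> sets (marchenko_pastur z1 z2)"
    using assms by (simp add: sets_marchenko_pastur)
  show "positive (sets (marchenko_pastur z1 z2)) (\<lambda>A. ?f A + ?g A)"
    by (simp add: positive_def)
  show "countably_additive (sets (marchenko_pastur z1 z2)) (\<lambda>A. ?f A + ?g A)"
  proof (rule countably_additiveI)
    fix B :: "nat \<Rightarrow> real set"
    assume B: "range B \<subseteq> sets (marchenko_pastur z1 z2)" "disjoint_family B"
    have "(\<Sum>i. ?f (B i)) = ?f (\<Union>i. B i)"
      using suminf_emeasure[of B "return borel (0::real)"] B
      by (simp only: ennreal_suminf_cmult sets_marchenko_pastur sets_return)
    moreover have "(\<Sum>i. ?g (B i)) = ?g (\<Union>i. B i)"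
      using B by (intro suminf_emeasure) (auto simp: sets_marchenko_pastur)
    ultimately show "(\<Sum>i. ?f (B i) + ?g (B i)) = ?f (\<Union>i. B i) + ?g (\<Union>i. B i)"
      by (simp add: suminf_add[symmetric])
  qed
qed

text \<open>Euclidean distance of the first \<open>k\<close> coordinates:\<close>

definition coord_dist :: "nat \<Rightarrow> (nat \<Rightarrow> real) \<Rightarrow> (nat \<Rightarrow> real) \<Rightarrow> real" where
  "coord_dist k x y = L2_set (\<lambda>j. x j - y j) {1..k}"

end

theory Submission
  imports Defs "HOL-Computational_Algebra.Fundamental_Theorem_Algebra"
begin

text \<open>
  The idea is to pass from the moments \<open>m\<close> to the canonical moments \<open>z\<close>, which turn out to be
  independent, and to read every claim off their one-dimensional laws.

  Canonical moments have a combinatorial meaning: \<open>m\<^sub>j\<close> is the total weight of all Dyck paths of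
  length \<open>2j\<close>, where a down step from level \<open>i\<close> to \<open>i - 1\<close> has weight \<open>z\<^sub>i\<close> (the Stieltjes continued
  fraction).  Only one such path reaches level \<open>k\<close> within \<open>2k\<close> steps, so \<open>m\<^sub>k\<close> equals a function of
  \<open>z\<^sub>1, \<dots>, z\<^sub>k\<^sub>-\<^sub>1\<close> plus the product \<open>z\<^sub>1 \<cdots> z\<^sub>k\<close> (\<open>lowest_moment_cong\<close>).  For this parametrisation to be the
  one by canonical moments two facts are needed.  Every positive sequence \<open>z\<close> comes from a measure on
  the half line (\<open>measure_of_canonical\<close>): the polynomials \<open>Q\<^sub>h\<close> with recurrence coefficients \<open>z\<close> have
  real simple zeros by the Christoffel-Darboux identity, and Gauss quadrature at these zeros gives the
  measure.  Conversely \<open>z\<^sub>1 \<cdots> z\<^sub>k\<close> is the excess of \<open>m\<^sub>k\<close> over its least possible value, because the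
  integral of \<open>Q\<^sub>k(\<surd>x)\<^sup>2\<close> is nonnegative (\<open>moment_ge_lowest_moment\<close>).  Hence the interior of the moment
  space is exactly the image of the positive sequences (\<open>moment_space_interior_eq\<close>).

  The map from \<open>z\<close> to \<open>m\<close> is triangular with \<open>\<partial>m\<^sub>k/\<partial>z\<^sub>k = z\<^sub>1 \<cdots> z\<^sub>k\<^sub>-\<^sub>1\<close>, so integrating out one coordinate
  after the other (\<open>nn_integral_canonical\<close>) shows that under the given law the \<open>z\<^sub>i\<close> are independent
  with densities proportional to \<open>t\<^sup>n\<^sup>-\<^sup>i exp(-n V\<^sub>i(t)) = t\<^sup>-\<^sup>i exp(-n W\<^sub>i(t))\<close> (\<open>canonical_law\<close>).  Laplace's
  argument gives exponentially small mass, even against powers of \<open>t\<close>, away from the unique minimizer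
  of \<open>W\<^sub>i\<close> (\<open>canonical_weight_integral_concentration\<close>).  By the Borel-Cantelli lemma each \<open>z\<^sub>i\<close>, hence
  each \<open>m\<^sub>j\<close>, converges almost surely.  The same estimate bounds the upper limit of the expectation of
  \<open>m\<^sub>j\<close> by its almost sure limit, because \<open>m\<^sub>j\<close> is a polynomial in \<open>z\<close> with nonnegative coefficients; Scheffe's
  lemma then gives convergence in \<open>L\<^sup>1\<close>.  The tail assumption on the potentials is what makes the
  expectation of \<open>m\<^sub>j\<close> finite already for \<open>n = j\<close>.

  The limit is the weighted path sum with the two alternating weights \<open>z\<^sub>1\<^sup>*, z\<^sub>2\<^sup>*\<close>.  Contracting the steps in
  pairs, starting from level one, turns the paths into Motzkin paths with constant weights, and these
  are counted by binomial transforms of ballot numbers (\<open>moment_of_canonical_periodic\<close>).  On the other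
  side, \<open>x\<close> times the Marchenko-Pastur law is, up to a factor, an affine image of a semicircle law, whose moments satisfy a
  two-term recursion (\<open>moment_marchenko_pastur\<close>).  Both computations give the stated sum.
\<close>


section \<open>Moments as weighted Dyck paths\<close>

text \<open>Paths of \<open>t\<close> steps from level \<open>0\<close> to level \<open>h\<close>, split by the last step: it goes up with weight one, or
  down from level \<open>h + 1\<close>, and then its weight is indexed by the level which it leaves.\<close>

primrec path_sum :: "(nat \<Rightarrow> real) \<Rightarrow> nat \<Rightarrow> nat \<Rightarrow> real" where
  "path_sum z 0 h = (if h = 0 then 1 else 0)"
| "path_sum z (Suc t) h =
     (case h of 0 \<Rightarrow> 0 | Suc g \<Rightarrow> path_sum z t g) + z (Suc h) * path_sum z t (Suc h)"

definition moment_of_canonical :: "(nat \<Rightarrow> real) \<Rightarrow> nat \<Rightarrow> real" where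
  "moment_of_canonical z j = path_sum z (2 * j) 0"

lemma path_sum_above: "t < h \<Longrightarrow> path_sum z t h = 0"
  by (induction t arbitrary: h) (auto split: nat.splits)

lemma path_sum_straight: "path_sum z h h = 1"
  by (induction h) (auto simp: path_sum_above)

lemma path_sum_cong:
  assumes "\<And>i. 1 \<le> i \<Longrightarrow> 2 * i \<le> t + h \<Longrightarrow> z i = z' i"
  shows "path_sum z t h = path_sum z' t h"
  using assms
proof (induction t arbitrary: h)
  case (Suc t)
  have "path_sum z t g = path_sum z' t g" if "h = Suc g" for g
    using Suc.prems that by (intro Suc.IH) auto
  moreover have "z (Suc h) * path_sum z t (Suc h) = z' (Suc h) * path_sum z' t (Suc h)"
  proof (cases "t < Suc h")
    case False
    then have "path_sum z t (Suc h) = path_sum z' t (Suc h)"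
      using Suc.prems by (intro Suc.IH) auto
    moreover have "z (Suc h) = z' (Suc h)" using False Suc.prems[of "Suc h"] by simp
    ultimately show ?thesis by simp
  qed (simp add: path_sum_above)
  ultimately show ?case by (auto split: nat.splits)
qed simp

lemma moment_of_canonical_cong:
  assumes "\<And>i. 1 \<le> i \<Longrightarrow> i \<le> j \<Longrightarrow> z i = z' i"
  shows "moment_of_canonical z j = moment_of_canonical z' j"
  unfolding moment_of_canonical_def by (rule path_sum_cong) (use assms in auto)

text \<open>A path from \<open>0\<close> to \<open>h\<close> with \<open>h + 2r\<close> steps visits level \<open>h + r\<close> only if it climbs straight up and then
  straight down.  So \<open>z\<^sub>h\<^sub>+\<^sub>r\<close> enters through a single monomial, and subtracting that
  monomial leaves an expression in the weights of lower index.\<close>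

lemma path_sum_highest:
  assumes "\<And>i. 1 \<le> i \<Longrightarrow> i < h + r \<Longrightarrow> z i = z' i" and "r \<ge> 1"
  shows "path_sum z (h + 2 * r) h - (\<Prod>i\<in>{h<..h + r}. z i) =
         path_sum z' (h + 2 * r) h - (\<Prod>i\<in>{h<..h + r}. z' i)"
  using assms
proof (induction "h + 2 * r" arbitrary: h r)
  case (Suc t)
  have up: "path_sum z t g = path_sum z' t g" if "h = Suc g" for g
    using Suc.prems Suc.hyps(2) that by (intro path_sum_cong) auto
  have down: "z (Suc h) * path_sum z t (Suc h) - (\<Prod>i\<in>{h<..h + r}. z i) =
      z' (Suc h) * path_sum z' t (Suc h) - (\<Prod>i\<in>{h<..h + r}. z' i)"
  proof (cases "r = 1")
    case True
    then have "t = Suc h" "{h<..h + r} = {Suc h}" using Suc.hyps(2) by auto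
    then show ?thesis by (simp only: path_sum_straight) simp
  next
    case False
    then have r: "r \<ge> 2" using Suc.prems by simp
    have t: "t = Suc h + 2 * (r - 1)" using Suc.hyps(2) r by simp
    have ins: "{h<..h + r} = insert (Suc h) {Suc h<..Suc h + (r - 1)}" using r by auto
    have "path_sum z t (Suc h) - (\<Prod>i\<in>{Suc h<..Suc h + (r - 1)}. z i) =
        path_sum z' t (Suc h) - (\<Prod>i\<in>{Suc h<..Suc h + (r - 1)}. z' i)"
      using Suc.hyps(1)[OF t] Suc.prems r t by simp
    moreover have "z (Suc h) = z' (Suc h)" using Suc.prems r by simp
    ultimately show ?thesis
      unfolding ins by simp (metis diff_eq_eq add_diff_eq add.commute right_diff_distrib diff_add_eq)
  qed
  show ?case
    unfolding Suc.hyps(2)[symmetric] path_sum.simps using up down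
    by (auto split: nat.splits)
qed simp

text \<open>The value of the \<open>k\<close>-th moment for \<open>z\<^sub>k = 0\<close>.  By \<open>moment_ge_lowest_moment\<close> it is a lower bound for the
  \<open>k\<close>-th moment when the earlier moments are prescribed.\<close>

definition lowest_moment :: "(nat \<Rightarrow> real) \<Rightarrow> nat \<Rightarrow> real" where
  "lowest_moment z k = moment_of_canonical z k - (\<Prod>i=1..k. z i)"

lemma lowest_moment_cong:
  assumes "\<And>i. 1 \<le> i \<Longrightarrow> i < k \<Longrightarrow> z i = z' i" "k \<ge> 1"
  shows "lowest_moment z k = lowest_moment z' k"
proof -
  have "{0<..k} = {1..k}" by auto
  then show ?thesis
    using path_sum_highest[of 0 k z z'] assms
    by (simp add: lowest_moment_def moment_of_canonical_def)
qed


section \<open>Orthogonal polynomials and Gauss quadrature\<close>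

text \<open>The monic polynomials with three-term recurrence \<open>x Q\<^sub>h = Q\<^sub>h\<^sub>+\<^sub>1 + z\<^sub>h Q\<^sub>h\<^sub>-\<^sub>1\<close>.  They belong to the symmetric measure
  on the whole line whose image under squaring has the moments given by \<open>z\<close>.  The ground field is
  left open because their zeros are found in the complex numbers.\<close>

fun orth_poly :: "(nat \<Rightarrow> real) \<Rightarrow> nat \<Rightarrow> 'a::real_field poly" where
  "orth_poly z 0 = 1"
| "orth_poly z (Suc 0) = [:0, 1:]"
| "orth_poly z (Suc (Suc h)) =
     pCons 0 (orth_poly z (Suc h)) - smult (of_real (z (Suc h))) (orth_poly z h)"

lemma orth_poly_step:
  "x * poly (orth_poly z h) x = poly (orth_poly z (Suc h)) x +
     of_real (z h) * (case h of 0 \<Rightarrow> 0 | Suc g \<Rightarrow> poly (orth_poly z g) x)"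
  by (cases h) (auto)

lemma degree_orth_poly: "degree (orth_poly z h) \<le> h"
  by (induction z h rule: orth_poly.induct)
     (auto intro!: degree_diff_le order.trans[OF degree_smult_le] degree_pCons_le order.trans[OF degree_pCons_le])

lemma coeff_orth_poly: "coeff (orth_poly z h) h = 1"
proof (induction z h rule: orth_poly.induct)
  case (3 z h)
  have "coeff (orth_poly z h :: 'a poly) (Suc (Suc h)) = 0"
    using degree_orth_poly[where 'a='a, of z h] by (intro coeff_eq_0) simp
  then show ?case using 3 by simp
qed auto

lemma degree_orth_poly_eq: "degree (orth_poly z h :: 'a::real_field poly) = h"
  using le_degree[of "orth_poly z h :: 'a poly" h] degree_orth_poly[where 'a='a, of z h]
  by (simp add: coeff_orth_poly order_antisym)

lemma orth_poly_nonzero: "orth_poly z h \<noteq> (0 :: 'a::real_field poly)"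
  using coeff_orth_poly[where 'a='a, of z h] by auto

lemma coeff_orth_poly_parity: "odd (h + i) \<Longrightarrow> coeff (orth_poly z h) i = 0"
proof (induction z h arbitrary: i rule: orth_poly.induct)
  case (3 z h)
  then show ?case by (cases i) auto
qed (auto simp: coeff_pCons odd_pos split: nat.splits)

text \<open>Multiplication by \<open>x\<close> acts on the basis \<open>Q\<^sub>h\<close> as one step of the path: up with weight one and down from \<open>h\<close>
  with weight \<open>z\<^sub>h\<close>.  Therefore path sums are the coordinates of powers in this basis.\<close>

lemma power_eq_path_sum:
  "x ^ t = (\<Sum>h\<le>t. path_sum z t h * poly (orth_poly z h) x)" for x :: real
proof (induction t)
  case (Suc t)
  define Q where "Q h = poly (orth_poly z h) x" for h
  have a: "(\<Sum>h\<le>t. path_sum z t h * Q (Suc h)) =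
      (\<Sum>h\<le>Suc t. (case h of 0 \<Rightarrow> 0 | Suc g \<Rightarrow> path_sum z t g) * Q h)"
    by (subst sum.atMost_Suc_shift) simp
  have "(\<Sum>h\<le>t. path_sum z t h * (z h * (case h of 0 \<Rightarrow> 0 | Suc g \<Rightarrow> Q g))) =
      (\<Sum>h\<le>Suc (Suc t). path_sum z t h * (z h * (case h of 0 \<Rightarrow> 0 | Suc g \<Rightarrow> Q g)))"
    by (simp add: path_sum_above)
  also have "\<dots> = (\<Sum>h\<le>Suc t. z (Suc h) * path_sum z t (Suc h) * Q h)"
    by (subst sum.atMost_Suc_shift) (simp add: mult_ac)
  finally have b: "(\<Sum>h\<le>t. path_sum z t h * (z h * (case h of 0 \<Rightarrow> 0 | Suc g \<Rightarrow> Q g))) =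
      (\<Sum>h\<le>Suc t. z (Suc h) * path_sum z t (Suc h) * Q h)" .
  have "x ^ Suc t = (\<Sum>h\<le>t. path_sum z t h * (x * Q h))"
    using Suc by (simp add: Q_def sum_distrib_left mult_ac)
  also have "\<dots> = (\<Sum>h\<le>t. path_sum z t h * Q (Suc h)) +
      (\<Sum>h\<le>t. path_sum z t h * (z h * (case h of 0 \<Rightarrow> 0 | Suc g \<Rightarrow> Q g)))"
    unfolding Q_def orth_poly_step by (simp add: distrib_left sum.distrib)
  also have "\<dots> = (\<Sum>h\<le>Suc t. path_sum z (Suc t) h * Q h)"
    unfolding a b by (simp add: sum.distrib[symmetric] algebra_simps del: sum.atMost_Suc)
  finally show ?case by (simp only: Q_def)
qed simp

lemma christoffel_darboux:
  fixes x y :: "'a::real_field"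
  assumes "\<And>i. i \<ge> 1 \<Longrightarrow> z i \<noteq> 0"
  shows "(x - y) * (\<Sum>j\<le>N. poly (orth_poly z j) x * poly (orth_poly z j) y /
            of_real (\<Prod>i=1..j. z i)) =
     (poly (orth_poly z (Suc N)) x * poly (orth_poly z N) y -
      poly (orth_poly z N) x * poly (orth_poly z (Suc N)) y) / of_real (\<Prod>i=1..N. z i)"
proof (induction N)
  case (Suc N)
  have nz: "(of_real (\<Prod>i=1..N. z i) :: 'a) \<noteq> 0" "(of_real (z (Suc N)) :: 'a) \<noteq> 0"
    using assms by (auto simp del: of_real_prod)
  show ?case
    unfolding sum.atMost_Suc distrib_left Suc.IH
    using nz by (simp del: of_real_prod add: field_simps)
qed simp

text \<open>The limit \<open>y \<rightarrow> x\<close> of the Christoffel-Darboux identity.\<close>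

lemma christoffel_darboux_confluent:
  fixes x :: "'a::real_field"
  assumes "\<And>i. i \<ge> 1 \<Longrightarrow> z i \<noteq> 0"
  shows "(\<Sum>j\<le>N. (poly (orth_poly z j) x)\<^sup>2 / of_real (\<Prod>i=1..j. z i)) =
     (poly (pderiv (orth_poly z (Suc N))) x * poly (orth_poly z N) x -
      poly (pderiv (orth_poly z N)) x * poly (orth_poly z (Suc N)) x) /
      of_real (\<Prod>i=1..N. z i)"
proof (induction N)
  case 0
  show ?case by (simp add: pderiv_pCons)
next
  case (Suc N)
  have nz: "(of_real (\<Prod>i=1..N. z i) :: 'a) \<noteq> 0" "(of_real (z (Suc N)) :: 'a) \<noteq> 0"
    using assms by (auto simp del: of_real_prod)
  show ?case
    unfolding sum.atMost_Suc Suc.IH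
    using nz by (simp del: of_real_prod add: field_simps pderiv_pCons pderiv_diff pderiv_smult power2_eq_square)
qed

lemma poly_orth_poly_of_real:
  "poly (orth_poly z h) (of_real x :: 'a::real_field) = of_real (poly (orth_poly z h) x)"
  by (induction z h rule: orth_poly.induct) auto

lemma pderiv_orth_poly_of_real:
  "poly (pderiv (orth_poly z h)) (of_real x :: 'a::real_field) =
     of_real (poly (pderiv (orth_poly z h)) x)"
  by (induction z h rule: orth_poly.induct)
     (auto simp: pderiv_pCons pderiv_diff pderiv_smult poly_orth_poly_of_real)

lemma poly_orth_poly_cnj: "poly (orth_poly z h) (cnj x) = cnj (poly (orth_poly z h) x)"
  by (induction z h rule: orth_poly.induct) auto

text \<open>For a zero \<open>x\<close> the Christoffel-Darboux identity at \<open>x\<close> and its conjugate has right-hand side \<open>0\<close>, while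
  the sum on the left is at least the contribution \<open>1\<close> of \<open>Q\<^sub>0\<close>; so \<open>x\<close> equals its conjugate.\<close>

lemma orth_poly_complex_root_real:
  assumes z: "\<And>i. i \<ge> 1 \<Longrightarrow> z i > 0" and x: "poly (orth_poly z (Suc N)) x = (0::complex)"
  shows "x \<in> \<real>"
proof -
  have nz: "\<And>i. i \<ge> 1 \<Longrightarrow> z i \<noteq> 0" using z by force
  have h: "(\<Prod>i=1..j. z i) > 0" for j using z by (intro prod_pos) auto
  define S where "S = (\<Sum>j\<le>N. (cmod (poly (orth_poly z j) x))\<^sup>2 / (\<Prod>i=1..j. z i))"
  have "S \<ge> (cmod (poly (orth_poly z 0) x))\<^sup>2 / (\<Prod>i=1..0. z i)"
    unfolding S_def using h by (intro member_le_sum) (auto intro!: divide_nonneg_pos)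
  then have S: "S > 0" by simp
  have "of_real S = (\<Sum>j\<le>N. poly (orth_poly z j) x * poly (orth_poly z j) (cnj x) /
      of_real (\<Prod>i=1..j. z i))"
    unfolding S_def of_real_sum of_real_divide complex_norm_square poly_orth_poly_cnj ..
  then have "(x - cnj x) * of_real S = 0"
    using christoffel_darboux[of z x "cnj x" N] nz x by (simp add: poly_orth_poly_cnj)
  then have "x = cnj x" using S by simp
  then show ?thesis by (metis Reals_cnj_iff)
qed

text \<open>All complex zeros are real, and they are simple: at a double zero the confluent identity would force a
  sum of nonnegative terms containing \<open>Q\<^sub>0\<^sup>2 = 1\<close> to vanish.\<close>

lemma card_roots_orth_poly:
  assumes z: "\<And>i. i \<ge> 1 \<Longrightarrow> z i > 0"
  shows "card {x::real. poly (orth_poly z (Suc N)) x = 0} = Suc N"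
proof -
  let ?P = "orth_poly z (Suc N) :: complex poly"
  have nz: "\<And>i. i \<ge> 1 \<Longrightarrow> z i \<noteq> 0" using z by force
  have h: "(\<Prod>i=1..j. z i) > 0" for j using z by (intro prod_pos) auto
  have img: "{x. poly ?P x = 0} = of_real ` {x::real. poly (orth_poly z (Suc N)) x = 0}"
  proof (intro set_eqI iffI)
    fix x assume x: "x \<in> {x. poly ?P x = 0}"
    then obtain r where "x = of_real r"
      using orth_poly_complex_root_real[of z N x] z by (auto elim: Reals_cases)
    with x show "x \<in> of_real ` {x::real. poly (orth_poly z (Suc N)) x = 0}"
      by (auto simp: poly_orth_poly_of_real)
  qed (auto simp: poly_orth_poly_of_real simp del: orth_poly.simps)
  have "rsquarefree ?P"
    unfolding rsquarefree_roots
  proof (intro allI notI, elim conjE)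
    fix a assume a: "poly ?P a = 0" "poly (pderiv ?P) a = 0"
    then obtain r where r: "a = of_real r"
      using orth_poly_complex_root_real[of z N a] z by (auto elim: Reals_cases)
    have r0: "poly (orth_poly z (Suc N)) r = 0" "poly (pderiv (orth_poly z (Suc N))) r = 0"
      using a unfolding r poly_orth_poly_of_real pderiv_orth_poly_of_real by simp_all
    have "(\<Sum>j\<le>N. (poly (orth_poly z j) r)\<^sup>2 / (\<Prod>i=1..j. z i)) \<ge>
        (poly (orth_poly z 0) r)\<^sup>2 / (\<Prod>i=1..0. z i)"
      using h by (intro member_le_sum) (auto intro!: divide_nonneg_pos)
    then show False using christoffel_darboux_confluent[of z r N] nz r0 by simp
  qed
  from complex_poly_decompose_rsquarefree[OF this]
  have dec: "smult (lead_coeff ?P) (\<Prod>x | poly ?P x = 0. [:-x, 1:]) = ?P" .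
  have "degree ?P = degree (\<Prod>x | poly ?P x = 0. [:-x, 1:])"
    by (subst dec[symmetric]) (simp add: degree_orth_poly_eq coeff_orth_poly del: orth_poly.simps)
  also have "\<dots> = card {x. poly ?P x = 0}"
    by (subst degree_prod_eq_sum_degree) auto
  finally have "card {x. poly ?P x = 0} = Suc N" by (simp only: degree_orth_poly_eq)
  then show ?thesis unfolding img by (subst (asm) card_image) (auto simp: inj_on_def)
qed

lemma orth_poly_independent:
  assumes "(\<Sum>j\<le>N. smult (c j) (orth_poly z j)) = 0" "j \<le> N"
  shows "c j = 0"
  using assms
proof (induction N arbitrary: j)
  case (Suc N)
  have "coeff (\<Sum>j\<le>N. smult (c j) (orth_poly z j)) (Suc N) = 0"
    by (auto simp: coeff_sum intro!: sum.neutral coeff_eq_0 le_imp_less_Suc order.trans[OF degree_orth_poly])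
  then have top: "c (Suc N) = 0"
    using arg_cong[OF Suc.prems(1), of "\<lambda>p. coeff p (Suc N)"]
    by (simp add: coeff_orth_poly del: orth_poly.simps)
  then show ?case using Suc by (cases "j = Suc N") auto
qed (auto)

text \<open>The nodes are the zeros of \<open>Q\<^sub>N\<^sub>+\<^sub>1\<close>, the weights the inverse values \<open>1 / K(x, x)\<close> of the kernel
  \<open>K(x, y) = \<Sum> Q\<^sub>j(x) Q\<^sub>j(y) / (z\<^sub>1 \<cdots> z\<^sub>j)\<close>.  By Christoffel-Darboux \<open>K\<close> vanishes at pairs of distinct nodes.
  So interpolating \<open>Q\<^sub>i\<close> at the nodes by means of \<open>K\<close> reproduces it there, and then everywhere because the degrees are at
  most \<open>N\<close> and there are \<open>N + 1\<close> nodes; comparing coefficients in the basis \<open>Q\<^sub>j\<close> gives orthogonality.\<close>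

lemma gauss_quadrature:
  assumes z: "\<And>i. i \<ge> 1 \<Longrightarrow> z i > 0"
  obtains R :: "real set" and w where "finite R" "\<And>x. x \<in> R \<Longrightarrow> w x > 0"
    "\<And>i j. i \<le> N \<Longrightarrow> j \<le> N \<Longrightarrow>
      (\<Sum>x\<in>R. w x * (poly (orth_poly z i) x * poly (orth_poly z j) x)) =
      (if i = j then \<Prod>l=1..i. z l else 0)"
proof
  define R where "R = {x::real. poly (orth_poly z (Suc N)) x = 0}"
  define h where "h j = (\<Prod>l=1..j. z l)" for j
  define K where "K x y = (\<Sum>j\<le>N. poly (orth_poly z j) x * poly (orth_poly z j) y / h j)" for x y :: real
  have h: "h j > 0" for j using z unfolding h_def by (intro prod_pos) auto
  have nz: "\<And>i. i \<ge> 1 \<Longrightarrow> z i \<noteq> 0" using z by force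
  show fin: "finite R" unfolding R_def by (intro poly_roots_finite orth_poly_nonzero)
  have cardR: "card R = Suc N" unfolding R_def using card_roots_orth_poly z by blast
  have "K x x \<ge> poly (orth_poly z 0) x * poly (orth_poly z 0) x / h 0" for x
    unfolding K_def using h by (intro member_le_sum) (auto intro!: divide_nonneg_pos)
  then have Kpos: "K x x > 0" for x using less_le_trans[of 0 1 "K x x"] by (simp add: h_def)
  have K0: "K x y = 0" if "x \<in> R" "y \<in> R" "x \<noteq> y" for x y
  proof -
    have "(x - y) * K x y = 0"
      using christoffel_darboux[of z x y N] nz that unfolding K_def h_def R_def by simp
    then show ?thesis using that by simp
  qed
  show "1 / K x x > 0" for x using Kpos[of x] by simp
  fix i j assume i: "i \<le> N" and j: "j \<le> N"
  \<comment> \<open>the coefficients, in the basis \<open>Q\<^sub>j\<close>, of the interpolation error of \<open>Q\<^sub>i\<close>\<close>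
  define c where "c j = (\<Sum>x\<in>R. 1 / K x x * (poly (orth_poly z i) x * poly (orth_poly z j) x)) / h j
      - (if i = j then 1 else 0)" for j
  define S :: "real poly" where "S = (\<Sum>j\<le>N. smult (c j) (orth_poly z j))"
  have "poly S y = 0" if y: "y \<in> R" for y
  proof -
    have "poly S y = (\<Sum>j\<le>N. \<Sum>x\<in>R. 1 / K x x * poly (orth_poly z i) x *
          (poly (orth_poly z j) x * poly (orth_poly z j) y / h j))
        - (\<Sum>j\<le>N. if i = j then poly (orth_poly z j) y else 0)"
      unfolding S_def c_def poly_sum sum_subtractf[symmetric]
      by (intro sum.cong refl) (simp add: algebra_simps sum_distrib_right sum_distrib_left sum_divide_distrib)
    also have "(\<Sum>j\<le>N. if i = j then poly (orth_poly z j) y else 0) = poly (orth_poly z i) y"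
      using i by simp
    also have "(\<Sum>j\<le>N. \<Sum>x\<in>R. 1 / K x x * poly (orth_poly z i) x *
          (poly (orth_poly z j) x * poly (orth_poly z j) y / h j)) =
        (\<Sum>x\<in>R. 1 / K x x * poly (orth_poly z i) x * K x y)"
      by (subst sum.swap) (simp only: K_def sum_distrib_left)
    also have "\<dots> = (\<Sum>x\<in>R. if x = y then poly (orth_poly z i) y else 0)"
      using K0[OF _ y] Kpos by (intro sum.cong) (auto simp: less_imp_neq[symmetric])
    also have "\<dots> = poly (orth_poly z i) y" using fin y by simp
    finally show ?thesis by simp
  qed
  moreover have "degree S \<le> N"
    unfolding S_def
    by (intro degree_sum_le)
      (auto intro!: order.trans[OF degree_smult_le] order.trans[OF degree_orth_poly])
  ultimately have "S = 0"
    using poly_roots_finite[of S] card_mono[of "{x. poly S x = 0}" R] card_poly_roots_bound[of S] cardR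
    by fastforce
  then have "c j = 0" using orth_poly_independent[of c z N j] j unfolding S_def by simp
  then have "(\<Sum>x\<in>R. 1 / K x x * (poly (orth_poly z i) x * poly (orth_poly z j) x)) =
      (if i = j then 1 else 0) * h j"
    using h[of j] unfolding c_def by (simp add: divide_eq_eq del: times_divide_eq_left)
  then show "(\<Sum>x\<in>R. 1 / K x x * (poly (orth_poly z i) x * poly (orth_poly z j) x)) =
      (if i = j then \<Prod>l=1..i. z l else 0)"
    by (auto simp: h_def)
qed

lemma quadrature_moment:
  fixes z :: "nat \<Rightarrow> real"
  assumes orth: "\<And>i j. i \<le> N \<Longrightarrow> j \<le> N \<Longrightarrow>
      (\<Sum>x\<in>R. w x * (poly (orth_poly z i) x * poly (orth_poly z j) x)) =
      (if i = j then \<Prod>l=1..i. z l else 0)"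
    and "2 * j \<le> N"
  shows "(\<Sum>x\<in>R. w x * x ^ (2 * j)) = moment_of_canonical z j"
proof -
  have "(\<Sum>x\<in>R. w x * x ^ (2 * j)) =
      (\<Sum>x\<in>R. \<Sum>h\<le>2 * j. path_sum z (2 * j) h * (w x * (poly (orth_poly z h) x * poly (orth_poly z 0) x)))"
    unfolding power_eq_path_sum[of _ _ z] by (simp add: sum_distrib_left mult_ac)
  also have "\<dots> = (\<Sum>h\<le>2 * j. path_sum z (2 * j) h *
      (\<Sum>x\<in>R. w x * (poly (orth_poly z h) x * poly (orth_poly z 0) x)))"
    by (subst sum.swap) (simp only: sum_distrib_left)
  also have "\<dots> = (\<Sum>h\<le>2 * j. if h = 0 then path_sum z (2 * j) h else 0)"
    using assms(2) by (intro sum.cong refl) (subst orth, auto)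
  also have "\<dots> = moment_of_canonical z j"
    by (simp add: moment_of_canonical_def)
  finally show ?thesis .
qed

lemma moment_of_canonical_0 [simp]: "moment_of_canonical z 0 = 1"
  by (simp add: moment_of_canonical_def)

text \<open>The squares of the quadrature nodes carry a measure on the half line whose \<open>j\<close>-th moment is the
  quadrature sum of \<open>x\<^sup>2\<^sup>j\<close>.\<close>

lemma measure_of_canonical:
  assumes z: "\<And>i. i \<ge> 1 \<Longrightarrow> z i > 0"
  obtains \<mu> where "\<mu> \<in> half_line_measures"
    "\<And>j. j \<le> n \<Longrightarrow> moment \<mu> j = moment_of_canonical z j"
proof -
  obtain R w where R: "finite R" and w: "\<And>x. x \<in> R \<Longrightarrow> w x > 0"
    and orth: "\<And>i j. i \<le> 2 * n \<Longrightarrow> j \<le> 2 * n \<Longrightarrow>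
      (\<Sum>x\<in>R. w x * (poly (orth_poly z i) x * poly (orth_poly z j) x)) =
      (if i = j then \<Prod>l=1..i. z l else 0)"
    using gauss_quadrature[of z "2 * n"] z by metis
  define M where "M = point_measure R (\<lambda>x. ennreal (w x))"
  define \<mu> where "\<mu> = distr M borel (\<lambda>x::real. x\<^sup>2)"
  have meas: "(\<lambda>x::real. x\<^sup>2) \<in> borel_measurable M"
    by (simp add: M_def)
  have w0: "\<And>x. x \<in> R \<Longrightarrow> w x \<ge> 0" using w by (simp add: less_imp_le)
  have mom: "moment \<mu> j = (\<Sum>x\<in>R. w x * x ^ (2 * j))" for j
    unfolding moment_def \<mu>_def M_def
    by (subst integral_distr) (auto simp: lebesgue_integral_point_measure_finite R w0 power_mult)
  show thesis
  proof
    show "moment \<mu> j = moment_of_canonical z j" if "j \<le> n" for j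
      unfolding mom using that by (intro quadrature_moment[OF orth]) auto
    have "emeasure M (space M) = ennreal (\<Sum>x\<in>R. w x)"
      using R w0 by (simp add: M_def space_point_measure emeasure_point_measure_finite)
    also have "(\<Sum>x\<in>R. w x) = 1"
      using quadrature_moment[OF orth, of 0] by simp
    finally have "prob_space M" by (intro prob_spaceI) simp
    then have "prob_space \<mu>" unfolding \<mu>_def by (intro prob_space.prob_space_distr meas)
    moreover have "emeasure \<mu> {..<0} = 0"
      unfolding \<mu>_def by (subst emeasure_distr[OF meas]) (auto simp: vimage_def not_less)
    moreover have "integrable \<mu> (\<lambda>x. x ^ j)" for j
      unfolding \<mu>_def M_def
      by (subst integrable_distr_eq) (auto simp: integrable_point_measure_finite R)
    ultimately show "\<mu> \<in> half_line_measures"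
      by (simp add: half_line_measures_def \<mu>_def)
  qed
qed

text \<open>\<open>Q\<^sub>k\<close> has the parity of \<open>k\<close>.  So \<open>Q\<^sub>k\<^sup>2\<close> is a polynomial in \<open>y\<^sup>2\<close>, which may be integrated against a measure on
  the half line by substituting \<open>y\<^sup>2 = x\<close>.\<close>

lemma orth_poly_square_even:
  fixes y :: real
  shows "(poly (orth_poly z k) y)\<^sup>2 =
    (\<Sum>j\<le>k. coeff (orth_poly z k * orth_poly z k) (2 * j) * y ^ (2 * j))"
proof -
  let ?Q = "orth_poly z k :: real poly"
  have odd0: "coeff (?Q * ?Q) i = 0" if "odd i" for i
    unfolding coeff_mult
  proof (intro sum.neutral ballI)
    fix l assume "l \<in> {..i}"
    then have "odd (k + l) \<or> odd (k + (i - l))" using that by (simp add: Nat.le_imp_diff_is_add) presburger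
    then show "coeff ?Q l * coeff ?Q (i - l) = 0" by (metis coeff_orth_poly_parity mult_eq_0_iff)
  qed
  have deg: "degree (?Q * ?Q) = 2 * k"
    by (simp add: degree_mult_eq orth_poly_nonzero degree_orth_poly_eq)
  have "(poly ?Q y)\<^sup>2 = (\<Sum>i\<le>2 * k. coeff (?Q * ?Q) i * y ^ i)"
    unfolding power2_eq_square poly_mult[symmetric] by (simp add: poly_altdef deg)
  also have "\<dots> = (\<Sum>i\<in>(\<lambda>j. 2 * j) ` {..k}. coeff (?Q * ?Q) i * y ^ i)"
  proof (intro sum.mono_neutral_right ballI)
    fix i assume "i \<in> {..2 * k} - (\<lambda>j. 2 * j) ` {..k}"
    then have "odd i" by (auto elim!: evenE)
    then show "coeff (?Q * ?Q) i * y ^ i = 0" using odd0 by simp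
  qed auto
  also have "\<dots> = (\<Sum>j\<le>k. coeff (?Q * ?Q) (2 * j) * y ^ (2 * j))"
    by (subst sum.reindex) (auto simp: inj_on_def)
  finally show ?thesis .
qed

text \<open>The integral of \<open>Q\<^sub>k(\<surd>x)\<^sup>2\<close> is nonnegative and has the form \<open>m\<^sub>k\<close> plus a combination of lower moments.
  For the quadrature measure the same combination evaluates to \<open>z\<^sub>1 \<cdots> z\<^sub>k\<close>, and the two measures share the
  moments below \<open>k\<close>; the difference of the two values is the difference of the \<open>k\<close>-th moments.\<close>

lemma moment_ge_lowest_moment:
  assumes z: "\<And>i. i \<ge> 1 \<Longrightarrow> z i > 0" and \<mu>: "\<mu> \<in> half_line_measures"
    and eq: "\<And>j. 1 \<le> j \<Longrightarrow> j < k \<Longrightarrow> moment \<mu> j = moment_of_canonical z j"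
  shows "lowest_moment z k \<le> moment \<mu> k"
proof -
  let ?Q = "orth_poly z k :: real poly"
  define c where "c j = coeff (?Q * ?Q) (2 * j)" for j
  interpret prob_space \<mu> using \<mu> by (simp add: half_line_measures_def)
  have sets [measurable_cong]: "sets \<mu> = sets borel" and int: "\<And>j. integrable \<mu> (\<lambda>x. x ^ j)"
    and neg: "emeasure \<mu> {..<0} = 0"
    using \<mu> by (auto simp: half_line_measures_def)
  have m0: "moment \<mu> 0 = 1" by (simp add: moment_def prob_space)
  have "coeff (?Q * ?Q) (degree ?Q + degree ?Q) = 1"
    unfolding coeff_mult_degree_sum by (simp add: coeff_orth_poly degree_orth_poly_eq)
  then have ck: "c k = 1" by (simp add: c_def degree_orth_poly_eq mult_2)
  obtain R w where R: "finite R" and w: "\<And>x. x \<in> R \<Longrightarrow> w x > 0"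
    and orth: "\<And>i j. i \<le> 2 * k \<Longrightarrow> j \<le> 2 * k \<Longrightarrow>
      (\<Sum>x\<in>R. w x * (poly (orth_poly z i) x * poly (orth_poly z j) x)) =
      (if i = j then \<Prod>l=1..i. z l else 0)"
    using gauss_quadrature[of z "2 * k"] z by metis
  have "(\<Prod>l=1..k. z l) = (\<Sum>x\<in>R. w x * (poly ?Q x * poly ?Q x))"
    using orth[of k k] by simp
  also have "\<dots> = (\<Sum>x\<in>R. w x * (\<Sum>j\<le>k. c j * x ^ (2 * j)))"
    unfolding power2_eq_square[symmetric] orth_poly_square_even c_def ..
  also have "\<dots> = (\<Sum>j\<le>k. c j * (\<Sum>x\<in>R. w x * x ^ (2 * j)))"
    unfolding sum_distrib_left by (subst sum.swap) (simp add: mult_ac)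
  also have "\<dots> = (\<Sum>j\<le>k. c j * moment_of_canonical z j)"
    by (intro sum.cong refl arg_cong2[of _ _ _ _ "(*)"] quadrature_moment[OF orth]) auto
  finally have prod: "(\<Prod>l=1..k. z l) = (\<Sum>j\<le>k. c j * moment_of_canonical z j)" .
  have AE: "AE x in \<mu>. 0 \<le> x"
    using neg by (intro AE_I[of _ _ "{..<0}"]) (auto simp: sets)
  have "0 \<le> (\<integral>x. (\<Sum>j\<le>k. c j * x ^ j) \<partial>\<mu>)"
  proof (rule integral_nonneg_AE)
    from AE show "AE x in \<mu>. 0 \<le> (\<Sum>j\<le>k. c j * x ^ j)"
    proof eventually_elim
      case (elim x)
      have "(\<Sum>j\<le>k. c j * x ^ j) = (poly ?Q (sqrt x))\<^sup>2"
        unfolding orth_poly_square_even c_def power_mult using elim by simp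
      then show ?case by simp
    qed
  qed
  also have "\<dots> = (\<Sum>j\<le>k. c j * moment \<mu> j)"
    by (simp add: moment_def Bochner_Integration.integral_sum int)
  finally have "(\<Sum>j\<le>k. c j * moment_of_canonical z j) - (\<Prod>l=1..k. z l) \<le> (\<Sum>j\<le>k. c j * moment \<mu> j)"
    using prod by simp
  moreover have "(\<Sum>j<k. c j * moment \<mu> j) = (\<Sum>j<k. c j * moment_of_canonical z j)"
  proof (intro sum.cong refl)
    fix j assume "j \<in> {..<k}"
    then show "c j * moment \<mu> j = c j * moment_of_canonical z j"
      using eq[of j] m0 by (cases "j = 0") auto
  qed
  ultimately show ?thesis
    by (simp add: lessThan_Suc_atMost[symmetric] ck lowest_moment_def)
qed


section \<open>Canonical moments as coordinates of the moment space\<close>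

text \<open>The inverse of \<open>moment_of_canonical\<close>, solving \<open>m\<^sub>k = lowest_moment + z\<^sub>1 \<cdots> z\<^sub>k\<close> for one coordinate at a time.
  Coordinates which are not determined yet are set to \<open>1\<close>, so that the sequence is positive as a
  whole as soon as the computed entries are, as quadrature requires.\<close>

primrec canonical_of_moments :: "(nat \<Rightarrow> real) \<Rightarrow> nat \<Rightarrow> nat \<Rightarrow> real" where
  "canonical_of_moments m 0 = (\<lambda>_. 1)"
| "canonical_of_moments m (Suc k) = (canonical_of_moments m k)(Suc k :=
     (m (Suc k) - lowest_moment (canonical_of_moments m k) (Suc k)) /
     (\<Prod>i=1..k. canonical_of_moments m k i))"

lemma canonical_of_moments_outside:
  "i = 0 \<or> k < i \<Longrightarrow> canonical_of_moments m k i = 1"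
  by (induction k) auto

lemma canonical_of_moments_stable:
  "i \<le> k \<Longrightarrow> canonical_of_moments m k i = canonical_of_moments m i i"
proof (induction k)
  case (Suc k)
  then show ?case by (cases "i = Suc k") auto
qed simp

lemma canonical_of_moments_cong:
  assumes "\<And>j. 1 \<le> j \<Longrightarrow> j \<le> k \<Longrightarrow> m j = m' j"
  shows "canonical_of_moments m k = canonical_of_moments m' k"
  using assms by (induction k) auto

lemma canonical_of_moments_pos:
  assumes "\<forall>i\<in>{1..n}. canonical_of_moments m n i > 0" and "k \<le> n"
  shows "canonical_of_moments m k i > 0"
proof (cases "i = 0 \<or> k < i")
  case False
  then have "canonical_of_moments m k i = canonical_of_moments m n i"
    using assms(2) by (simp add: canonical_of_moments_stable[of i k] canonical_of_moments_stable[of i n])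
  then show ?thesis using assms False by simp
qed (simp add: canonical_of_moments_outside)

lemma moment_of_canonical_of_moments:
  assumes pos: "\<forall>i\<in>{1..n}. canonical_of_moments m n i > 0" and k: "1 \<le> k" "k \<le> n"
  shows "moment_of_canonical (canonical_of_moments m n) k = m k"
proof -
  obtain l where l: "k = Suc l" using k by (cases k) auto
  let ?z = "canonical_of_moments m n"
  have eq: "?z i = canonical_of_moments m k i" if "i \<le> k" for i
    using that k by (simp add: canonical_of_moments_stable[of i k] canonical_of_moments_stable[of i n])
  have eql: "canonical_of_moments m l i = canonical_of_moments m k i" if "i \<le> l" for i
    using that l by simp
  define P where "P = (\<Prod>i=1..l. canonical_of_moments m l i)"
  have p: "P > 0"
    unfolding P_def using canonical_of_moments_pos[OF pos, of l] k l by (intro prod_pos) auto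
  have "lowest_moment ?z k = lowest_moment (canonical_of_moments m l) k"
    using k l by (intro lowest_moment_cong) (auto simp: eq)
  moreover have "(\<Prod>i=1..k. ?z i) = P * canonical_of_moments m k k"
    unfolding l P_def using eq eql l by (simp del: canonical_of_moments.simps)
  moreover have "canonical_of_moments m k k =
      (m k - lowest_moment (canonical_of_moments m l) k) / P"
    by (simp add: l P_def)
  moreover have "moment_of_canonical ?z k = lowest_moment ?z k + (\<Prod>i=1..k. ?z i)"
    by (simp add: lowest_moment_def)
  ultimately show ?thesis using p by simp
qed

text \<open>The moment vectors that have positive canonical moments.  This will be the interior of the moment
  space.\<close>

definition canonical_domain :: "nat \<Rightarrow> (nat \<Rightarrow> real) set" where
  "canonical_domain n =
     {m \<in> extensional {1..n}. \<forall>i\<in>{1..n}. canonical_of_moments m n i > 0}"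

lemma canonical_domain_subset_moment_space: "canonical_domain n \<subseteq> moment_space n"
proof
  fix m assume m: "m \<in> canonical_domain n"
  then have pos: "\<forall>i\<in>{1..n}. canonical_of_moments m n i > 0" and m_ext: "m \<in> extensional {1..n}"
    by (auto simp: canonical_domain_def)
  obtain \<mu> where \<mu>: "\<mu> \<in> half_line_measures"
    "\<And>j. j \<le> n \<Longrightarrow> moment \<mu> j = moment_of_canonical (canonical_of_moments m n) j"
    using measure_of_canonical[of "canonical_of_moments m n" n] canonical_of_moments_pos[OF pos]
    by auto
  have "m = (\<lambda>j\<in>{1..n}. moment \<mu> j)"
  proof
    fix j
    show "m j = (\<lambda>j\<in>{1..n}. moment \<mu> j) j"
      using m_ext \<mu>(2)[of j] moment_of_canonical_of_moments[OF pos, of j]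
        extensional_arb[OF m_ext, of j]
      by (cases "j \<in> {1..n}") auto
  qed
  then show "m \<in> moment_space n" using \<mu>(1) by (auto simp: moment_space_def)
qed

lemma continuous_on_path_sum:
  assumes "\<And>i. continuous_on S (\<lambda>m. f m i)"
  shows "continuous_on S (\<lambda>m. path_sum (f m) t h)"
proof (induction t arbitrary: h)
  case (Suc t)
  then show ?case using assms by (cases h) (auto intro!: continuous_intros)
qed simp

text \<open>Openness and continuity are proved together: the domain for \<open>n + 1\<close> is cut out of the domain for \<open>n\<close> by
  positivity of a quotient whose denominator is positive there.\<close>

lemma canonical_of_moments_continuous:
  "open {m. \<forall>i\<in>{1..n}. canonical_of_moments m n i > 0} \<and>
   (\<forall>i. continuous_on {m. \<forall>i\<in>{1..n}. canonical_of_moments m n i > 0}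
      (\<lambda>m. canonical_of_moments m n i))"
proof (induction n)
  case (Suc n)
  define W where "W = {m. \<forall>i\<in>{1..n}. canonical_of_moments m n i > 0}"
  have oW: "open W" and cW: "\<And>i. continuous_on W (\<lambda>m. canonical_of_moments m n i)"
    using Suc by (auto simp: W_def)
  have c: "continuous_on W (\<lambda>m. canonical_of_moments m (Suc n) i)" for i
  proof (cases "i = Suc n")
    case True
    have "continuous_on W (\<lambda>m. (m (Suc n) - lowest_moment (canonical_of_moments m n) (Suc n)) /
        (\<Prod>i=1..n. canonical_of_moments m n i))"
    proof (rule continuous_on_divide)
      show "continuous_on W (\<lambda>m. m (Suc n) - lowest_moment (canonical_of_moments m n) (Suc n))"
        unfolding lowest_moment_def moment_of_canonical_def
        by (intro continuous_intros continuous_on_path_sum cW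
            continuous_on_subset[OF continuous_on_product_coordinates]) auto
      show "continuous_on W (\<lambda>m. \<Prod>i = 1..n. canonical_of_moments m n i)"
        by (intro continuous_intros cW)
      show "\<forall>m\<in>W. (\<Prod>i = 1..n. canonical_of_moments m n i) \<noteq> 0"
        by (force simp: W_def prod_zero_iff)
    qed
    then show ?thesis using True by simp
  next
    case False
    then show ?thesis using cW by simp
  qed
  have st: "canonical_of_moments m (Suc n) i = canonical_of_moments m n i" if "i \<in> {1..n}" for m i
    using that by simp
  have eq: "{m. \<forall>i\<in>{1..Suc n}. canonical_of_moments m (Suc n) i > 0} =
      W \<inter> (\<lambda>m. canonical_of_moments m (Suc n) (Suc n)) -` {0<..}"
    by (auto simp: W_def atLeastAtMostSuc_conv st simp del: canonical_of_moments.simps(2))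
  show ?case
    unfolding eq
  proof (intro conjI allI)
    show "open (W \<inter> (\<lambda>m. canonical_of_moments m (Suc n) (Suc n)) -` {0<..})"
      by (intro continuous_open_preimage c oW) simp
    show "continuous_on (W \<inter> (\<lambda>m. canonical_of_moments m (Suc n) (Suc n)) -` {0<..})
        (\<lambda>m. canonical_of_moments m (Suc n) i)" for i
      by (rule continuous_on_subset[OF c]) auto
  qed
qed simp

text \<open>Vectors are extensional functions, so their entries outside \<open>{1..n}\<close> are constant.  The inclusion into the
  space of all sequences is therefore continuous, and openness can be pulled back from there.\<close>

lemma openin_canonical_domain: "openin (powertop_real {1..n}) (canonical_domain n)"
proof -
  have "continuous_map (powertop_real {1..n}) (product_topology (\<lambda>_. euclideanreal) UNIV) (\<lambda>m. m)"
    unfolding continuous_map_componentwise_UNIV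
  proof
    fix k :: nat
    show "continuous_map (powertop_real {1..n}) euclideanreal (\<lambda>m. m k)"
    proof (cases "k \<in> {1..n}")
      case True then show ?thesis by (rule continuous_map_product_projection)
    next
      case False
      have "continuous_map (powertop_real {1..n}) euclideanreal (\<lambda>m. undefined)" by simp
      then show ?thesis
        by (rule continuous_map_eq) (use False in \<open>auto simp: PiE_def extensional_def\<close>)
    qed
  qed
  then have "continuous_map (powertop_real {1..n}) euclidean (\<lambda>m. m)"
    by (simp add: euclidean_product_topology)
  then have "openin (powertop_real {1..n}) {m \<in> topspace (powertop_real {1..n}).
      m \<in> {m. \<forall>i\<in>{1..n}. canonical_of_moments m n i > 0}}"
    using canonical_of_moments_continuous[of n] by (intro openin_continuous_map_preimage) auto
  moreover have "canonical_domain n = {m \<in> topspace (powertop_real {1..n}).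
      m \<in> {m. \<forall>i\<in>{1..n}. canonical_of_moments m n i > 0}}"
    by (auto simp: canonical_domain_def PiE_def)
  ultimately show ?thesis by simp
qed

lemma moment_space_interior_decrease:
  assumes m: "m \<in> moment_space_interior n" and k: "k \<in> {1..n}"
  obtains \<delta> where "\<delta> > 0" "m(k := m k - \<delta>) \<in> moment_space n"
proof -
  obtain T where T: "openin (powertop_real {1..n}) T" "T \<subseteq> moment_space n" "m \<in> T"
    using m unfolding moment_space_interior_def interior_of_def by auto
  have ext: "m \<in> extensional {1..n}"
    using openin_subset[OF T(1)] T(3) by (auto simp: PiE_def)
  have "continuous_map euclideanreal (powertop_real {1..n}) (\<lambda>t. m(k := t))"
    unfolding continuous_map_componentwise using ext k
    by (auto simp: extensional_def continuous_map_iff_continuous2)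
  from openin_continuous_map_preimage[OF this T(1)] have "open {t. m(k := t) \<in> T}"
    by simp
  moreover have "m k \<in> {t. m(k := t) \<in> T}" using T(3) by simp
  ultimately obtain e where e: "e > 0" "ball (m k) e \<subseteq> {t. m(k := t) \<in> T}"
    by (rule openE)
  show thesis
  proof
    show "e / 2 > 0" using e by simp
    have "m k - e / 2 \<in> ball (m k) e" using e by (simp add: dist_real_def)
    then have "m k - e / 2 \<in> {t. m(k := t) \<in> T}" using e(2) by blast
    then show "m(k := m k - e / 2) \<in> moment_space n" using T(2) by blast
  qed
qed

text \<open>An interior point remains a moment vector after slightly lowering its \<open>k\<close>-th entry.  The lower bound
  on \<open>k\<close>-th moments therefore holds strictly, that is, \<open>z\<^sub>k > 0\<close>.  The other inclusion is openness.\<close>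

lemma moment_space_interior_eq: "moment_space_interior n = canonical_domain n"
proof
  show "canonical_domain n \<subseteq> moment_space_interior n"
    unfolding moment_space_interior_def
    using openin_canonical_domain canonical_domain_subset_moment_space by (rule interior_of_maximal[rotated])
  show "moment_space_interior n \<subseteq> canonical_domain n"
  proof
    fix m assume m: "m \<in> moment_space_interior n"
    have "m \<in> moment_space n"
      using m interior_of_subset[of "powertop_real {1..n}" "moment_space n"]
      by (auto simp: moment_space_interior_def)
    then have ext: "m \<in> extensional {1..n}" by (auto simp: moment_space_def)
    have "\<forall>i\<in>{1..k}. canonical_of_moments m k i > 0" if "k \<le> n" for k
      using that
    proof (induction k)
      case (Suc k)
      then have pos: "\<forall>i\<in>{1..k}. canonical_of_moments m k i > 0" by simp
      define z where "z = canonical_of_moments m k"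
      have z: "z i > 0" for i using canonical_of_moments_pos[OF pos] by (simp add: z_def)
      obtain \<delta> where \<delta>: "\<delta> > 0" "m(Suc k := m (Suc k) - \<delta>) \<in> moment_space n"
        using moment_space_interior_decrease[OF m, of "Suc k"] Suc.prems by auto
      then obtain \<mu> where \<mu>: "\<mu> \<in> half_line_measures"
        "m(Suc k := m (Suc k) - \<delta>) = (\<lambda>j\<in>{1..n}. moment \<mu> j)"
        by (auto simp: moment_space_def)
      have "moment \<mu> j = moment_of_canonical z j" if "1 \<le> j" "j < Suc k" for j
        using fun_cong[OF \<mu>(2), of j] moment_of_canonical_of_moments[OF pos, of j] that Suc.prems
        by (simp add: z_def)
      then have "lowest_moment z (Suc k) \<le> moment \<mu> (Suc k)"
        using z \<mu>(1) by (intro moment_ge_lowest_moment) auto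
      also have "moment \<mu> (Suc k) = m (Suc k) - \<delta>"
        using fun_cong[OF \<mu>(2), of "Suc k"] Suc.prems by simp
      finally have "0 < m (Suc k) - lowest_moment z (Suc k)" using \<delta> by simp
      moreover have "(\<Prod>i=1..k. z i) > 0" using z by (intro prod_pos) auto
      ultimately show ?case
        using pos by (auto simp: z_def le_Suc_eq)
    qed simp
    then show "m \<in> canonical_domain n" using ext by (simp add: canonical_domain_def)
  qed
qed

text \<open>The range of possible \<open>k\<close>-th moments is bounded below by the lowest moment and approaches it, as
  \<open>z\<^sub>k\<close> may be any positive number.  So the excess is \<open>z\<^sub>1 \<cdots> z\<^sub>k\<close>, and a quotient of successive
  excesses is a single \<open>z\<^sub>k\<close>.\<close>

lemma canonical_moment_eq:
  assumes "m \<in> canonical_domain n" and k: "1 \<le> k" "k \<le> n"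
  shows "canonical_moment m k = canonical_of_moments m n k"
proof -
  define z where "z = canonical_of_moments m n"
  have pos: "\<forall>i\<in>{1..n}. canonical_of_moments m n i > 0"
    using assms by (simp add: canonical_domain_def)
  have z: "z i > 0" for i using canonical_of_moments_pos[OF pos] by (simp add: z_def)
  have mz: "m j = moment_of_canonical z j" if "1 \<le> j" "j \<le> n" for j
    using moment_of_canonical_of_moments[OF pos that] by (simp add: z_def)
  have excess: "moment_excess m j = (\<Prod>i=1..j. z i)" if j: "j \<le> n" for j
  proof (cases "j = 0")
    case True
    then show ?thesis by (simp add: moment_excess_def lower_moment_def)
  next
    case False
    have "Inf (moment_range m j) = lowest_moment z j"
    proof (rule cInf_eq_non_empty)
      obtain \<mu> where \<mu>: "\<mu> \<in> half_line_measures" "\<And>l. l \<le> n \<Longrightarrow> moment \<mu> l = moment_of_canonical z l"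
        using measure_of_canonical[of z n] z by auto
      then have "moment \<mu> j \<in> moment_range m j"
        unfolding moment_range_def mem_Collect_eq
        using j mz by (intro exI[of _ \<mu>]) auto
      then show "moment_range m j \<noteq> {}" by auto
    next
      fix x assume "x \<in> moment_range m j"
      then obtain \<mu> where \<mu>: "\<mu> \<in> half_line_measures" "\<forall>l\<in>{1..<j}. moment \<mu> l = m l" "x = moment \<mu> j"
        by (auto simp: moment_range_def)
      then show "lowest_moment z j \<le> x"
        using moment_ge_lowest_moment[of z \<mu> j] z mz j by simp
    next
      fix y assume y: "\<And>x. x \<in> moment_range m j \<Longrightarrow> y \<le> x"
      define H where "H = (\<Prod>i\<in>{1..j} - {j}. z i)"
      have H: "H > 0" unfolding H_def using z by (intro prod_pos) auto
      show "y \<le> lowest_moment z j"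
      proof (rule field_le_epsilon)
        fix e :: real assume e: "e > 0"
        \<comment> \<open>chosen so that the excess of the \<open>j\<close>-th moment becomes exactly \<open>e\<close>\<close>
        define z' where "z' = z(j := e / H)"
        have z': "z' i > 0" for i using z e H by (simp add: z'_def)
        have "(\<Prod>i=1..j. z' i) = z' j * (\<Prod>i\<in>{1..j} - {j}. z' i)"
          using False by (subst prod.remove[of _ j]) auto
        also have "(\<Prod>i\<in>{1..j} - {j}. z' i) = H"
          unfolding H_def by (intro prod.cong) (auto simp: z'_def)
        finally have P: "(\<Prod>i=1..j. z' i) = e" using H by (simp add: z'_def)
        obtain \<mu> where \<mu>: "\<mu> \<in> half_line_measures" "\<And>l. l \<le> j \<Longrightarrow> moment \<mu> l = moment_of_canonical z' l"
          using measure_of_canonical[of z' j] z' by auto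
        have "moment_of_canonical z' l = moment_of_canonical z l" if "l < j" for l
          using that by (intro moment_of_canonical_cong) (auto simp: z'_def)
        then have "moment \<mu> j \<in> moment_range m j"
          unfolding moment_range_def mem_Collect_eq
          using \<mu> mz j by (intro exI[of _ \<mu>]) auto
        then have "y \<le> moment_of_canonical z' j" using y \<mu>(2)[of j] by force
        also have "\<dots> = lowest_moment z' j + e" unfolding lowest_moment_def P by simp
        also have "lowest_moment z' j = lowest_moment z j"
          using False by (intro lowest_moment_cong) (auto simp: z'_def)
        finally show "y \<le> lowest_moment z j + e" .
      qed
    qed
    then show ?thesis
      using False j mz[of j] by (simp add: moment_excess_def lower_moment_def lowest_moment_def)
  qed
  obtain l where l: "k = Suc l" using k by (cases k) auto
  have "(\<Prod>i=1..l. z i) > 0" using z by (intro prod_pos) auto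
  moreover have "(\<Prod>i=1..k. z i) = (\<Prod>i=1..l. z i) * z k" unfolding l by simp
  ultimately have "(\<Prod>i=1..k. z i) / (\<Prod>i=1..l. z i) = z k"
    by (metis nonzero_mult_div_cancel_left less_irrefl)
  moreover have "k - 1 = l" using l by simp
  ultimately show ?thesis
    using excess[of k] excess[of l] k unfolding canonical_moment_def by (simp only: z_def)
qed


section \<open>Change of variables\<close>

lemma measurable_path_sum:
  assumes "\<And>i. (\<lambda>m. f m i) \<in> borel_measurable M"
  shows "(\<lambda>m. path_sum (f m) t h) \<in> borel_measurable M"
proof (induction t arbitrary: h)
  case (Suc t)
  then show ?case using assms by (cases h) auto
qed simp

lemma measurable_canonical_of_moments:
  "k \<le> n \<Longrightarrow> (\<lambda>m. canonical_of_moments m k i) \<in> borel_measurable (lebesgue_prod n)"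
proof (induction k arbitrary: i)
  case (Suc k)
  then have IH: "(\<lambda>m. canonical_of_moments m k i) \<in> borel_measurable (lebesgue_prod n)" for i
    by simp
  have m: "(\<lambda>m. m (Suc k)) \<in> borel_measurable (lebesgue_prod n)"
    unfolding lebesgue_prod_def using Suc.prems
    measurable_component_singleton[of "Suc k" "{1..n}" "\<lambda>_. lborel :: real measure"] by simp
  have "(\<lambda>m. (m (Suc k) - lowest_moment (canonical_of_moments m k) (Suc k)) /
     (\<Prod>i=1..k. canonical_of_moments m k i)) \<in> borel_measurable (lebesgue_prod n)"
    unfolding lowest_moment_def moment_of_canonical_def
    by (intro borel_measurable_divide borel_measurable_diff borel_measurable_prod
        measurable_path_sum IH m)
  then show ?case using IH by (cases "i = Suc k") auto
qed simp

lemma space_lebesgue_prod: "space (lebesgue_prod n) = extensional {1..n}"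
  by (simp add: lebesgue_prod_def space_PiM PiE_def)

lemma sets_canonical_domain: "canonical_domain n \<in> sets (lebesgue_prod n)"
proof -
  note [measurable] = measurable_canonical_of_moments[OF order.refl[of n]]
  have "{m \<in> space (lebesgue_prod n). \<forall>i\<in>{1..n}. 0 < canonical_of_moments m n i} \<in> sets (lebesgue_prod n)"
    by measurable
  then show ?thesis by (simp add: canonical_domain_def space_lebesgue_prod)
qed

lemma canonical_of_moments_upd:
  "canonical_of_moments (x(Suc n := y)) (Suc n) =
     (canonical_of_moments x n)(Suc n :=
       (y - lowest_moment (canonical_of_moments x n) (Suc n)) / (\<Prod>i=1..n. canonical_of_moments x n i))"
proof -
  have "canonical_of_moments (x(Suc n := y)) n = canonical_of_moments x n"
    by (rule canonical_of_moments_cong) simp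
  then show ?thesis by simp
qed

lemma canonical_domain_upd:
  assumes "x \<in> extensional {1..n}"
  shows "x(Suc n := y) \<in> canonical_domain (Suc n) \<longleftrightarrow>
    x \<in> canonical_domain n \<and> canonical_of_moments (x(Suc n := y)) (Suc n) (Suc n) > 0"
proof -
  have "x(Suc n := y) \<in> extensional {1..Suc n}"
    using assms by (auto simp: extensional_def)
  moreover have "canonical_of_moments (x(Suc n := y)) (Suc n) i = canonical_of_moments x n i"
    if "i \<in> {1..n}" for i
    unfolding canonical_of_moments_upd using that by simp
  ultimately show ?thesis
    using assms by (auto simp: canonical_domain_def atLeastAtMostSuc_conv
        simp del: canonical_of_moments.simps)
qed

text \<open>For fixed \<open>m\<^sub>1, \<dots>, m\<^sub>n\<close> the last moment is an affine function of \<open>z\<^sub>n\<^sub>+\<^sub>1\<close> with slope \<open>z\<^sub>1 \<cdots> z\<^sub>n\<close>.  Substituting it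
  multiplies each of the remaining factors by one power of its \<open>z\<^sub>i\<close>, so that after all steps \<open>z\<^sub>i\<close> has
  the exponent \<open>n - i\<close>.\<close>

lemma nn_integral_canonical:
  fixes g :: "nat \<Rightarrow> real \<Rightarrow> ennreal"
  assumes "\<And>i. g i \<in> borel_measurable borel"
  shows "(\<integral>\<^sup>+m. (\<Prod>i=1..n. g i (canonical_of_moments m n i)) * indicator (canonical_domain n) m
            \<partial>lebesgue_prod n) =
         (\<Prod>i=1..n. \<integral>\<^sup>+t. g i t * ennreal (t ^ (n - i)) * indicator {0<..} t \<partial>lborel)"
  using assms
proof (induction n arbitrary: g)
  case 0
  have "(\<lambda>_. undefined) \<in> canonical_domain 0" by (simp add: canonical_domain_def)
  then show ?case
    by (simp add: lebesgue_prod_def PiM_empty nn_integral_count_space_finite)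
next
  case (Suc n)
  note [measurable] = Suc.prems measurable_canonical_of_moments[OF order.refl]
    sets_canonical_domain
  interpret product_sigma_finite "\<lambda>_::nat. lborel :: real measure"
    by (simp add: product_sigma_finite_def lborel.sigma_finite_measure_axioms)
  define z where "z x = canonical_of_moments x n" for x
  define P where "P x = (\<Prod>i=1..n. z x i)" for x
  define C where "C = (\<integral>\<^sup>+t. g (Suc n) t * indicator {0<..} t \<partial>lborel)"
  let ?f = "\<lambda>m. (\<Prod>i=1..Suc n. g i (canonical_of_moments m (Suc n) i)) *
    indicator (canonical_domain (Suc n)) m"
  have ins: "lebesgue_prod (Suc n) = PiM (insert (Suc n) {1..n}) (\<lambda>_. lborel)"
    by (simp add: lebesgue_prod_def atLeastAtMostSuc_conv)
  have fm: "?f \<in> borel_measurable (lebesgue_prod (Suc n))" by measurable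
  have "(\<integral>\<^sup>+m. ?f m \<partial>lebesgue_prod (Suc n)) =
      (\<integral>\<^sup>+x. (\<integral>\<^sup>+y. ?f (x(Suc n := y)) \<partial>lborel) \<partial>lebesgue_prod n)"
    unfolding ins using fm unfolding ins lebesgue_prod_def[of n]
    by (intro product_nn_integral_insert) auto
  also have "\<dots> = (\<integral>\<^sup>+x. C * ((\<Prod>i=1..n. g i (z x i) * ennreal (z x i)) *
      indicator (canonical_domain n) x) \<partial>lebesgue_prod n)"
  proof (rule nn_integral_cong)
    fix x assume "x \<in> space (lebesgue_prod n)"
    then have x: "x \<in> extensional {1..n}" by (simp add: space_lebesgue_prod)
    define L where "L = lowest_moment (z x) (Suc n)"
    have f: "?f (x(Suc n := y)) = (\<Prod>i=1..n. g i (z x i)) * indicator (canonical_domain n) x *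
        (g (Suc n) ((y - L) / P x) * indicator {0<..} ((y - L) / P x))" for y
    proof -
      have "(\<Prod>i=1..Suc n. g i (canonical_of_moments (x(Suc n := y)) (Suc n) i)) =
          (\<Prod>i=1..n. g i (z x i)) * g (Suc n) ((y - L) / P x)"
        unfolding canonical_of_moments_upd z_def[symmetric] P_def[symmetric] L_def[symmetric]
        by simp
      moreover have "(indicator (canonical_domain (Suc n)) (x(Suc n := y)) :: ennreal) =
          indicator (canonical_domain n) x * indicator {0<..} ((y - L) / P x)"
        unfolding indicator_def canonical_domain_upd[OF x] canonical_of_moments_upd
          z_def[symmetric] P_def[symmetric] L_def[symmetric] by simp
      ultimately show ?thesis by (simp add: mult_ac)
    qed
    show "(\<integral>\<^sup>+y. ?f (x(Suc n := y)) \<partial>lborel) =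
        C * ((\<Prod>i=1..n. g i (z x i) * ennreal (z x i)) * indicator (canonical_domain n) x)"
    proof (cases "x \<in> canonical_domain n")
      case True
      then have zpos: "z x i > 0" if "i \<in> {1..n}" for i
        using that by (simp add: canonical_domain_def z_def)
      then have P: "P x > 0" unfolding P_def by (intro prod_pos) auto
      have "(\<integral>\<^sup>+y. g (Suc n) ((y - L) / P x) * indicator {0<..} ((y - L) / P x) \<partial>lborel) =
          ennreal (P x) * C"
        unfolding C_def using P
        by (subst nn_integral_real_affine[where c = "P x" and t = L]) auto
      moreover have "ennreal (P x) = (\<Prod>i=1..n. ennreal (z x i))"
        unfolding P_def using zpos by (subst prod_ennreal) (auto intro: less_imp_le)
      ultimately show ?thesis
        unfolding f using True
        by (subst nn_integral_cmult) (auto simp: prod.distrib mult_ac)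
    next
      case False
      then show ?thesis unfolding f by simp
    qed
  qed
  also have "\<dots> = C * (\<integral>\<^sup>+x. (\<Prod>i=1..n. g i (z x i) * ennreal (z x i)) *
      indicator (canonical_domain n) x \<partial>lebesgue_prod n)"
    unfolding z_def by (intro nn_integral_cmult) measurable
  also have "\<dots> = C * (\<Prod>i=1..n. \<integral>\<^sup>+t. g i t * ennreal t * ennreal (t ^ (n - i)) * indicator {0<..} t \<partial>lborel)"
    unfolding z_def by (subst Suc.IH[of "\<lambda>i t. g i t * ennreal t"]) auto
  also have "(\<Prod>i=1..n. \<integral>\<^sup>+t. g i t * ennreal t * ennreal (t ^ (n - i)) * indicator {0<..} t \<partial>lborel) =
      (\<Prod>i=1..n. \<integral>\<^sup>+t. g i t * ennreal (t ^ (Suc n - i)) * indicator {0<..} t \<partial>lborel)"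
  proof (intro prod.cong refl nn_integral_cong)
    fix i t assume i: "i \<in> {1..n}"
    show "g i t * ennreal t * ennreal (t ^ (n - i)) * indicator {0<..} t =
        g i t * ennreal (t ^ (Suc n - i)) * indicator {0<..} t"
      using i by (cases "t > 0") (auto simp: Suc_diff_le ennreal_mult mult_ac)
  qed
  also have "C * \<dots> = (\<Prod>i=1..Suc n. \<integral>\<^sup>+t. g i t * ennreal (t ^ (Suc n - i)) * indicator {0<..} t \<partial>lborel)"
    by (simp add: C_def mult_ac)
  finally show ?case .
qed


section \<open>Laplace concentration\<close>

text \<open>The unnormalised expectation of \<open>f(z\<^sub>i)\<close> for the moment vector of length \<open>n\<close>: the power of \<open>t\<close> is the
  Jacobian factor of \<open>nn_integral_canonical\<close>.\<close>

definition canonical_weight_integral ::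
    "(real \<Rightarrow> real) \<Rightarrow> nat \<Rightarrow> nat \<Rightarrow> (real \<Rightarrow> ennreal) \<Rightarrow> ennreal" where
  "canonical_weight_integral V n i f =
     (\<integral>\<^sup>+t. f t * ennreal (t ^ (n - i) * exp (- real n * V t)) * indicator {0<..} t \<partial>lborel)"

lemma admissible_continuous_pos:
  assumes "admissible_potential \<epsilon> V"
  shows "continuous_on {0<..} V"
  using assms unfolding admissible_potential_def C2_on_def
  by (metis DERIV_isCont continuous_at_imp_continuous_on)

lemma admissible_continuous:
  assumes "admissible_potential \<epsilon> V"
  shows "continuous_on {0..} V"
  unfolding continuous_on_eq_continuous_within
proof
  fix x :: real assume x: "x \<in> {0..}"
  show "continuous (at x within {0..}) V"
  proof (cases "x = 0")
    case True
    then show ?thesis using assms by (simp add: admissible_potential_def)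
  next
    case False
    then have "isCont V x"
      using x admissible_continuous_pos[OF assms] by (simp add: continuous_on_eq_continuous_at)
    then show ?thesis by (rule continuous_at_imp_continuous_at_within)
  qed
qed

lemma admissible_bounded_below:
  assumes "admissible_potential \<epsilon> V"
  obtains B where "\<And>t. 0 \<le> t \<Longrightarrow> t \<le> b \<Longrightarrow> B \<le> V t"
proof (cases "b \<ge> 0")
  case True
  have "continuous_on {0..b} V"
    using admissible_continuous[OF assms] by (rule continuous_on_subset) auto
  from continuous_attains_inf[OF compact_Icc _ this] True obtain x where
    "\<forall>y\<in>{0..b}. V x \<le> V y" by auto
  then show ?thesis using that[of "V x"] by simp
next
  case False
  then show ?thesis using that by simp
qed

lemma admissible_growth:
  assumes "admissible_potential \<epsilon> V"
  obtains b where "b > 1" "\<And>t. t \<ge> b \<Longrightarrow> (2 + \<epsilon>) * ln t \<le> V t"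
proof -
  from assms obtain b where b: "\<And>t. t \<ge> b \<Longrightarrow> V t / ln t \<ge> 2 + \<epsilon>"
    by (auto simp: admissible_potential_def eventually_at_top_linorder)
  show thesis
  proof
    show "max b 2 > (1::real)" by simp
    fix t assume t: "t \<ge> max b 2"
    then show "(2 + \<epsilon>) * ln t \<le> V t" using b[of t] by (simp add: le_divide_eq)
  qed
qed

text \<open>\<open>W = V - ln\<close> tends to infinity at \<open>0\<close>, where \<open>V\<close> stays bounded, and at infinity, where \<open>V\<close> exceeds \<open>2 ln\<close>.
  On the compact set that remains away from \<open>s\<close> it attains a minimum, which is larger than
  \<open>W(s)\<close> by uniqueness.\<close>

lemma minimizer_gap:
  assumes \<epsilon>: "\<epsilon> > 0" and V: "admissible_potential \<epsilon> V"
    and min: "unique_minimizer_on (\<lambda>z. V z - ln z) {0<..} s" and \<delta>: "\<delta> > 0"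
  obtains \<eta> where "\<eta> > 0"
    "\<And>t. t > 0 \<Longrightarrow> \<bar>t - s\<bar> \<ge> \<delta> \<Longrightarrow> V s - ln s + 2 * \<eta> \<le> V t - ln t"
proof -
  let ?w = "V s - ln s"
  have s: "s > 0" and smin0: "\<forall>t. t > 0 \<longrightarrow> ?w \<le> V t - ln t"
    using spec[OF min[unfolded unique_minimizer_on_def], of s] unfolding is_arg_min_def
    by (simp_all add: not_less) (metis not_le)
  note smin = smin0[rule_format]
  have uniq: "?w < V t - ln t" if "t > 0" "t \<noteq> s" for t
  proof (rule ccontr)
    assume "\<not> ?w < V t - ln t"
    then have "is_arg_min (\<lambda>z. V z - ln z) (\<lambda>y. y \<in> {0<..}) t"
      using that smin unfolding is_arg_min_def by (force simp: not_less)
    then show False using min that unfolding unique_minimizer_on_def by blast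
  qed
  obtain B where B: "\<And>t. 0 \<le> t \<Longrightarrow> t \<le> 1 \<Longrightarrow> B \<le> V t"
    using admissible_bounded_below[OF V, of 1] by blast
  obtain b0 where b0: "b0 > 1" "\<And>t. t \<ge> b0 \<Longrightarrow> (2 + \<epsilon>) * ln t \<le> V t"
    using admissible_growth[OF V] by blast
  \<comment> \<open>below \<open>a\<close> and above \<open>b\<close> the function exceeds its minimum by at least one\<close>
  define a where "a = min 1 (exp (B - ?w - 1))"
  define b where "b = max b0 (exp \<bar>?w + 1\<bar>)"
  have a: "0 < a" "a \<le> 1" by (auto simp: a_def)
  have b: "b > 1" using b0 by (simp add: b_def)
  have small: "?w + 1 \<le> V t - ln t" if "0 < t" "t \<le> a" for t
  proof -
    have "ln t \<le> B - ?w - 1"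
      using that by (metis a_def ln_exp ln_le_cancel_iff exp_gt_zero min.boundedE)
    moreover have "B \<le> V t" using that a by (intro B) auto
    ultimately show ?thesis by simp
  qed
  have large: "?w + 1 \<le> V t - ln t" if "b \<le> t" for t
  proof -
    have t: "t > 1" using that b by simp
    have "exp \<bar>?w + 1\<bar> \<le> t" using that by (simp add: b_def)
    then have "\<bar>?w + 1\<bar> \<le> ln t" using t by (simp add: ln_ge_iff)
    moreover have "(2 + \<epsilon>) * ln t \<le> V t" using that by (intro b0) (simp add: b_def)
    moreover have "0 \<le> \<epsilon> * ln t" using \<epsilon> t by simp
    ultimately show ?thesis by (simp add: algebra_simps)
  qed
  define K where "K = {a..b} \<inter> {t. \<delta> \<le> \<bar>t - s\<bar>}"
  have cK: "compact K"
    unfolding K_def by (intro compact_Int_closed compact_Icc closed_Collect_le continuous_intros)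
  have "\<exists>\<gamma>>0. \<forall>t\<in>K. ?w + \<gamma> \<le> V t - ln t"
  proof (cases "K = {}")
    case False
    have "continuous_on K (\<lambda>t. V t - ln t)"
      using a by (intro continuous_intros continuous_on_subset[OF admissible_continuous_pos[OF V]])
        (auto simp: K_def)
    from continuous_attains_inf[OF cK False this] obtain x where
      x: "x \<in> K" "\<And>t. t \<in> K \<Longrightarrow> V x - ln x \<le> V t - ln t" by blast
    have "?w < V x - ln x" using x(1) a \<delta> by (intro uniq) (auto simp: K_def)
    then show ?thesis using x(2) by (intro exI[of _ "V x - ln x - ?w"]) auto
  qed (auto intro: exI[of _ 1])
  then obtain \<gamma> where \<gamma>: "\<gamma> > 0" "\<And>t. t \<in> K \<Longrightarrow> ?w + \<gamma> \<le> V t - ln t" by blast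
  show thesis
  proof
    show "min 1 \<gamma> / 2 > 0" using \<gamma> by simp
    fix t assume t: "t > 0" "\<bar>t - s\<bar> \<ge> \<delta>"
    have "?w + min 1 \<gamma> \<le> V t - ln t"
    proof (cases "t \<le> a \<or> b \<le> t")
      case True
      then have "?w + 1 \<le> V t - ln t" using small[of t] large[of t] t by blast
      then show ?thesis by linarith
    next
      case False
      then have "t \<in> K" using t by (simp add: K_def)
      from \<gamma>(2)[OF this] show ?thesis by linarith
    qed
    then show "?w + 2 * (min 1 \<gamma> / 2) \<le> V t - ln t" by simp
  qed
qed

lemma admissible_measurable:
  assumes "admissible_potential \<epsilon> V"
  shows "(\<lambda>t. indicator {0<..} t * exp (- c * V t)) \<in> borel_measurable borel"
proof -
  have "continuous_on {0<..} (\<lambda>t. exp (- c * V t))"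
    by (intro continuous_intros admissible_continuous_pos[OF assms])
  then show ?thesis
    using borel_measurable_continuous_on_indicator[of "{0<..}" "\<lambda>t. exp (- c * V t)"] by simp
qed

lemma power_eq_exp_ln: "t > 0 \<Longrightarrow> t ^ k = exp (real k * ln t)" for t :: real
  by (simp add: exp_of_nat_mult)

text \<open>At infinity the integrand is at most \<open>t\<close> to the power \<open>p + n - i - n(2 + \<epsilon>)\<close>, which is at most \<open>-1 - \<epsilon>\<close>
  when \<open>p \<le> n\<close> and \<open>1 \<le> i\<close>.  This is where the constant \<open>2\<close> in the growth condition is used.\<close>

lemma canonical_weight_integral_finite:
  assumes \<epsilon>: "\<epsilon> > 0" and V: "admissible_potential \<epsilon> V"
    and i: "1 \<le> i" "i \<le> n" and p: "p \<le> n"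
  shows "canonical_weight_integral V n i (\<lambda>t. ennreal (t ^ p)) < \<infinity>"
proof -
  obtain b where b: "b > 1" "\<And>t. t \<ge> b \<Longrightarrow> (2 + \<epsilon>) * ln t \<le> V t"
    using admissible_growth[OF V] by blast
  obtain B where B: "\<And>t. 0 \<le> t \<Longrightarrow> t \<le> b \<Longrightarrow> B \<le> V t"
    using admissible_bounded_below[OF V, of b] by blast
  have bound: "ennreal (t ^ p) * ennreal (t ^ (n - i) * exp (- real n * V t)) * indicator {0<..} t \<le>
      ennreal (b ^ (p + (n - i)) * exp (- real n * B)) * indicator {0..b} t +
      ennreal (t powr (- 1 - \<epsilon>)) * indicator {b..} t" for t
  proof (cases "t > 0")
    case True
    have e: "ennreal (t ^ p) * ennreal (t ^ (n - i) * exp (- real n * V t)) =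
        ennreal (t ^ (p + (n - i)) * exp (- real n * V t))"
      using True by (simp add: ennreal_mult[symmetric] power_add mult_ac)
    show ?thesis
    proof (cases "t \<le> b")
      case le: True
      have "t ^ (p + (n - i)) * exp (- real n * V t) \<le> b ^ (p + (n - i)) * exp (- real n * B)"
        using True le B[of t] b by (intro mult_mono power_mono) (auto intro!: mult_left_mono)
      then show ?thesis
        unfolding e using True le by (auto intro!: order.trans[OF _ add_increasing2] ennreal_leI)
    next
      case False
      have t: "t > 1" using False b by simp
      have lnt: "ln t > 0" using t by simp
      have V': "(2 + \<epsilon>) * ln t \<le> V t" using False by (intro b) simp
      have "t ^ (p + (n - i)) * exp (- real n * V t) = exp (real (p + (n - i)) * ln t - real n * V t)"
        using t power_eq_exp_ln[of t "p + (n - i)"] by (simp only: exp_diff exp_minus divide_inverse mult_minus_left)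
      also have "\<dots> \<le> exp ((- 1 - \<epsilon>) * ln t)"
      proof -
        have "real (p + (n - i)) * ln t - real n * V t \<le>
            real (p + (n - i)) * ln t - real n * ((2 + \<epsilon>) * ln t)"
          using V' by (simp add: mult_left_mono)
        also have "\<dots> = (real p - real n - real i - real n * \<epsilon>) * ln t"
          using i by (simp add: of_nat_diff algebra_simps)
        also have "\<dots> \<le> (- 1 - \<epsilon>) * ln t"
        proof (rule mult_right_mono)
          have "1 * \<epsilon> \<le> real n * \<epsilon>" using i \<epsilon> by (intro mult_right_mono) auto
          then show "real p - real n - real i - real n * \<epsilon> \<le> - 1 - \<epsilon>" using p i by simp
        qed (use lnt in simp)
        finally show ?thesis by simp
      qed
      also have "\<dots> = t powr (- 1 - \<epsilon>)" using t by (simp add: powr_def)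
      finally show ?thesis
        unfolding e using False True by (auto intro!: ennreal_leI)
    qed
  qed auto
  have tail: "(\<integral>\<^sup>+t. ennreal (t powr (- 1 - \<epsilon>)) * indicator {b..} t \<partial>lborel) =
      ennreal (0 - (- (b powr (- \<epsilon>)) / \<epsilon>))"
  proof (rule nn_integral_FTC_atLeast)
    fix x assume x: "b \<le> x"
    then show "DERIV (\<lambda>t. - (t powr (- \<epsilon>)) / \<epsilon>) x :> x powr (- 1 - \<epsilon>)"
      using b \<epsilon> by (auto intro!: derivative_eq_intros simp: minus_diff_commute)
    show "0 \<le> x powr (- 1 - \<epsilon>)" by simp
  next
    have "((\<lambda>t. t powr (- \<epsilon>)) \<longlongrightarrow> 0) at_top"
      using \<epsilon> by (intro tendsto_neg_powr filterlim_ident) simp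
    from tendsto_divide[OF tendsto_minus[OF this] tendsto_const[of \<epsilon>]] \<epsilon>
    show "((\<lambda>t. - (t powr (- \<epsilon>)) / \<epsilon>) \<longlongrightarrow> 0) at_top"
      by simp
  qed simp
  have "canonical_weight_integral V n i (\<lambda>t. ennreal (t ^ p)) \<le>
      (\<integral>\<^sup>+t. ennreal (b ^ (p + (n - i)) * exp (- real n * B)) * indicator {0..b} t +
      ennreal (t powr (- 1 - \<epsilon>)) * indicator {b..} t \<partial>lborel)"
    unfolding canonical_weight_integral_def by (intro nn_integral_mono bound)
  also have "\<dots> = ennreal (b ^ (p + (n - i)) * exp (- real n * B)) * ennreal b +
      ennreal (0 - (- (b powr (- \<epsilon>)) / \<epsilon>))"
    using b by (subst nn_integral_add) (auto simp: nn_integral_cmult_indicator tail)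
  also have "\<dots> < \<infinity>" by (simp add: ennreal_mult_less_top)
  finally show ?thesis .
qed

text \<open>Integration over a small interval around \<open>s\<close>, on which \<open>W\<close> exceeds \<open>W(s)\<close> by at most \<open>\<eta>\<close>.\<close>

lemma canonical_weight_integral_lower:
  assumes V: "admissible_potential \<epsilon> V"
    and s: "s > 0" and \<eta>: "\<eta> > 0"
  obtains c where "c > 0"
    "\<And>n. i \<le> n \<Longrightarrow> ennreal (c * exp (- real n * (V s - ln s + \<eta>))) \<le> canonical_weight_integral V n i (\<lambda>_. 1)"
proof -
  have "isCont (\<lambda>t. V t - ln t) s"
    using admissible_continuous_pos[OF V] s by (auto intro!: continuous_intros simp: continuous_on_eq_continuous_at)
  then obtain d where d: "d > 0" "\<And>t. \<bar>t - s\<bar> < d \<Longrightarrow> \<bar>(V t - ln t) - (V s - ln s)\<bar> < \<eta>"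
    using \<eta> unfolding continuous_at_eps_delta dist_real_def by metis
  define r where "r = min d s / 2"
  have r: "r > 0" "r < d" "r < s" using d s by (auto simp: r_def min_def)
  show thesis
  proof
    show "2 * r / (s + r) ^ i > 0" using r s by simp
    fix n assume n: "i \<le> n"
    have "ennreal (2 * r / (s + r) ^ i * exp (- real n * (V s - ln s + \<eta>))) =
        ennreal (exp (- real n * (V s - ln s + \<eta>)) / (s + r) ^ i) * emeasure lborel {s - r..s + r}"
      using r s by (simp add: ennreal_mult[symmetric] field_simps)
    also have "\<dots> = (\<integral>\<^sup>+t. ennreal (exp (- real n * (V s - ln s + \<eta>)) / (s + r) ^ i) *
        indicator {s - r..s + r} t \<partial>lborel)"
      by (simp add: nn_integral_cmult_indicator)
    also have "\<dots> \<le> canonical_weight_integral V n i (\<lambda>_. 1)"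
      unfolding canonical_weight_integral_def
    proof (intro nn_integral_mono)
      fix t
      show "ennreal (exp (- real n * (V s - ln s + \<eta>)) / (s + r) ^ i) * indicator {s - r..s + r} t \<le>
          1 * ennreal (t ^ (n - i) * exp (- real n * V t)) * indicator {0<..} t"
      proof (cases "t \<in> {s - r..s + r}")
        case True
        then have t: "t > 0" "t \<le> s + r" "\<bar>t - s\<bar> < d" using r by auto
        have "V t - ln t \<le> V s - ln s + \<eta>" using d(2)[OF t(3)] by linarith
        then have "exp (- real n * (V s - ln s + \<eta>)) / (s + r) ^ i \<le> exp (- real n * (V t - ln t)) / t ^ i"
          using t by (intro frac_le power_mono) (auto intro!: mult_left_mono)
        also have "\<dots> = t ^ (n - i) * exp (- real n * V t)"
          using t n by (simp add: power_diff right_diff_distrib exp_diff exp_minus exp_of_nat_mult field_simps)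
        finally show ?thesis using True t by (simp add: ennreal_leI)
      qed simp
    qed
    finally show "ennreal (2 * r / (s + r) ^ i * exp (- real n * (V s - ln s + \<eta>))) \<le>
        canonical_weight_integral V n i (\<lambda>_. 1)" .
  qed
qed

text \<open>Away from \<open>s\<close> all but \<open>n\<^sub>0\<close> of the \<open>n\<close> factors \<open>exp(-W)\<close> are bounded by \<open>exp(-W(s) - 2\<eta>)\<close>; the other \<open>n\<^sub>0\<close> are kept
  to make the integral converge.  The total mass is at least of order
  \<open>exp(-W(s) - \<eta>)\<close> per factor.\<close>

lemma canonical_weight_integral_concentration:
  assumes \<epsilon>: "\<epsilon> > 0" and V: "admissible_potential \<epsilon> V"
    and min: "unique_minimizer_on (\<lambda>z. V z - ln z) {0<..} s" and \<delta>: "\<delta> > 0" and i: "1 \<le> i"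
  obtains C \<eta> n0 where "C \<ge> 0" "\<eta> > 0"
    "\<And>n. n \<ge> n0 \<Longrightarrow>
      canonical_weight_integral V n i (\<lambda>t. ennreal (t ^ p) * indicator {t. \<bar>t - s\<bar> \<ge> \<delta>} t) \<le>
      ennreal (C * exp (- \<eta> * real n)) * canonical_weight_integral V n i (\<lambda>_. 1)"
proof -
  let ?w = "V s - ln s"
  have s: "s > 0" using min unfolding unique_minimizer_on_def is_arg_min_def by auto
  obtain \<eta> where \<eta>: "\<eta> > 0"
    "\<And>t. t > 0 \<Longrightarrow> \<bar>t - s\<bar> \<ge> \<delta> \<Longrightarrow> ?w + 2 * \<eta> \<le> V t - ln t"
    using minimizer_gap[OF \<epsilon> V min \<delta>] by blast
  obtain c where c: "c > 0"
    "\<And>n. i \<le> n \<Longrightarrow> ennreal (c * exp (- real n * (?w + \<eta>))) \<le> canonical_weight_integral V n i (\<lambda>_. 1)"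
    using canonical_weight_integral_lower[OF V s \<eta>(1), of i] by blast
  define n0 where "n0 = max i p"
  define A where "A = enn2real (canonical_weight_integral V n0 i (\<lambda>t. ennreal (t ^ p)))"
  have A: "canonical_weight_integral V n0 i (\<lambda>t. ennreal (t ^ p)) = ennreal A"
    unfolding A_def using canonical_weight_integral_finite[OF \<epsilon> V i, of n0 p]
    by (simp add: n0_def)
  have A0: "A \<ge> 0" by (simp add: A_def)
  note m = admissible_measurable[OF V, of "real n0"]
  show thesis
  proof
    show "A * exp (real n0 * (?w + 2 * \<eta>)) / c \<ge> 0" using A0 c by simp
    show "\<eta> > 0" by fact
    fix n assume n: "n \<ge> n0"
    then have ni: "i \<le> n" "i \<le> n0" by (auto simp: n0_def)
    have "canonical_weight_integral V n i (\<lambda>t. ennreal (t ^ p) * indicator {t. \<bar>t - s\<bar> \<ge> \<delta>} t) \<le>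
        (\<integral>\<^sup>+t. ennreal (exp (- real (n - n0) * (?w + 2 * \<eta>))) *
          (ennreal (t ^ p) * ennreal (t ^ (n0 - i) * exp (- real n0 * V t)) * indicator {0<..} t) \<partial>lborel)"
      unfolding canonical_weight_integral_def
    proof (intro nn_integral_mono)
      fix t :: real
      show "ennreal (t ^ p) * indicator {t. \<bar>t - s\<bar> \<ge> \<delta>} t *
            ennreal (t ^ (n - i) * exp (- real n * V t)) * indicator {0<..} t \<le>
          ennreal (exp (- real (n - n0) * (?w + 2 * \<eta>))) *
          (ennreal (t ^ p) * ennreal (t ^ (n0 - i) * exp (- real n0 * V t)) * indicator {0<..} t)"
      proof (cases "t > 0 \<and> \<bar>t - s\<bar> \<ge> \<delta>")
        case True
        then have t: "t > 0" by simp
        have "t ^ (n - i) * exp (- real n * V t) =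
            exp (- real (n - n0) * (V t - ln t)) * (t ^ (n0 - i) * exp (- real n0 * V t))"
        proof -
          have "t ^ (n - i) = t ^ (n - n0) * t ^ (n0 - i)"
            using n ni by (simp add: power_add[symmetric])
          moreover have "exp (- real n * V t) = exp (- real (n - n0) * V t) * exp (- real n0 * V t)"
            using n by (simp add: exp_add[symmetric] of_nat_diff algebra_simps)
          moreover have "exp (- real (n - n0) * (V t - ln t)) = t ^ (n - n0) * exp (- real (n - n0) * V t)"
            using t power_eq_exp_ln[of t "n - n0"] by (simp add: right_diff_distrib exp_diff exp_minus field_simps)
          ultimately show ?thesis by (simp only: mult_ac)
        qed
        also have "\<dots> \<le> exp (- real (n - n0) * (?w + 2 * \<eta>)) * (t ^ (n0 - i) * exp (- real n0 * V t))"
          using \<eta>(2)[of t] True by (intro mult_right_mono) (auto intro!: mult_left_mono)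
        finally have "t ^ p * (t ^ (n - i) * exp (- real n * V t)) \<le>
            exp (- real (n - n0) * (?w + 2 * \<eta>)) * (t ^ p * (t ^ (n0 - i) * exp (- real n0 * V t)))"
          using t by (subst mult.left_commute[of _ "t ^ p"]) (intro mult_left_mono, auto)
        from ennreal_leI[OF this] show ?thesis
          using True by (simp add: ennreal_mult)
      qed (auto simp: not_le)
    qed
    also have "\<dots> = ennreal (exp (- real (n - n0) * (?w + 2 * \<eta>))) * ennreal A"
      unfolding A[symmetric] canonical_weight_integral_def
    proof (rule nn_integral_cmult)
      have "(\<lambda>t. ennreal (t ^ p) * ennreal (t ^ (n0 - i) * exp (- real n0 * V t)) * indicator {0<..} t) =
          (\<lambda>t. ennreal (t ^ p) * ennreal (t ^ (n0 - i) * (indicator {0<..} t * exp (- real n0 * V t))))"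
        by (auto simp: fun_eq_iff indicator_def)
      then show "(\<lambda>t. ennreal (t ^ p) * ennreal (t ^ (n0 - i) * exp (- real n0 * V t)) * indicator {0<..} t)
          \<in> borel_measurable lborel"
        using m by simp
    qed
    also have "\<dots> = ennreal (A * exp (real n0 * (?w + 2 * \<eta>)) / c * exp (- \<eta> * real n)) *
        ennreal (c * exp (- real n * (?w + \<eta>)))"
    proof -
      have "exp (- real (n - n0) * (?w + 2 * \<eta>)) * A =
          A * exp (real n0 * (?w + 2 * \<eta>)) / c * exp (- \<eta> * real n) * (c * exp (- real n * (?w + \<eta>)))"
        using c n by (simp add: of_nat_diff exp_add[symmetric]) (simp add: exp_add[symmetric] algebra_simps)
      then show ?thesis using A0 c by (simp add: ennreal_mult[symmetric])
    qed
    also have "\<dots> \<le> ennreal (A * exp (real n0 * (?w + 2 * \<eta>)) / c * exp (- \<eta> * real n)) *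
        canonical_weight_integral V n i (\<lambda>_. 1)"
      using c(2)[OF ni(1)] by (rule mult_left_mono) simp
    finally show "canonical_weight_integral V n i (\<lambda>t. ennreal (t ^ p) * indicator {t. \<bar>t - s\<bar> \<ge> \<delta>} t) \<le>
        ennreal (A * exp (real n0 * (?w + 2 * \<eta>)) / c * exp (- \<eta> * real n)) *
        canonical_weight_integral V n i (\<lambda>_. 1)" .
  qed
qed


section \<open>Alternating canonical moments\<close>

text \<open>\<open>ballot u i\<close> is the number of paths with \<open>u\<close> steps of which \<open>i \<le> u/2\<close> go down and which stay nonnegative,
  by the reflection principle.\<close>

definition ballot :: "nat \<Rightarrow> nat \<Rightarrow> int" where
  "ballot u i = int (u choose i) - (if i = 0 then 0 else int (u choose (i - 1)))"

lemma ballot_0 [simp]: "ballot u 0 = 1"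
  by (simp add: ballot_def)

lemma ballot_Suc: "ballot (Suc u) (Suc i) = ballot u (Suc i) + ballot u i"
  by (cases i) (auto simp: ballot_def)

text \<open>This zero takes the place of the boundary condition at level \<open>0\<close>, below which no path may go.\<close>

lemma ballot_diagonal: "ballot (Suc (2 * i)) (Suc i) = 0"
proof -
  have "Suc (2 * i) choose Suc i = Suc (2 * i) choose i"
    using binomial_symmetric[of "Suc i" "Suc (2 * i)"] by simp
  then show ?thesis by (simp add: ballot_def)
qed

lemma ballot_catalan: "real_of_int (ballot (2 * i) i) = real ((2 * i) choose i) / real (i + 1)"
proof (cases i)
  case (Suc l)
  have "Suc (Suc l) * (2 * i choose Suc i) = i * (2 * i choose i)"
  proof -
    have "Suc i * (2 * i choose Suc i) = (2 * i - i) * (2 * i choose i)"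
      by (metis binomial_absorb_comp binomial_absorption mult.commute)
    then show ?thesis by (simp add: Suc)
  qed
  moreover have "(2 * i choose l) = (2 * i choose Suc i)"
    using binomial_symmetric[of l "2 * i"] by (simp add: Suc)
  ultimately have "real (i + 1) * real (2 * i choose l) = real i * real (2 * i choose i)"
    by (metis Suc Suc_eq_plus1 of_nat_mult)
  then show ?thesis
    by (simp add: ballot_def Suc field_simps)
qed simp

text \<open>Path sums with all weights equal to \<open>b\<close>, in closed form.\<close>

definition dyck_sum :: "real \<Rightarrow> nat \<Rightarrow> nat \<Rightarrow> real" where
  "dyck_sum b u h = (if h \<le> u \<and> even (u - h)
     then b ^ ((u - h) div 2) * of_int (ballot u ((u - h) div 2)) else 0)"

lemma dyck_sum_0: "dyck_sum b 0 h = (if h = 0 then 1 else 0)"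
  by (simp add: dyck_sum_def)

lemma dyck_sum_Suc:
  "dyck_sum b (Suc u) h = (case h of 0 \<Rightarrow> 0 | Suc g \<Rightarrow> dyck_sum b u g) + b * dyck_sum b u (Suc h)"
proof (cases "h \<le> Suc u \<and> even (Suc u - h)")
  case False
  then show ?thesis by (cases h) (auto simp: dyck_sum_def)
next
  case True
  then obtain i where "Suc u - h = 2 * i" by (blast elim: evenE)
  with True have i: "Suc u = h + 2 * i" by simp
  show ?thesis
  proof (cases h)
    case 0
    then obtain l where l: "i = Suc l" "u = Suc (2 * l)" using i by (cases i) auto
    have "ballot (Suc u) i = ballot u l"
      using ballot_diagonal[of l] by (simp add: l ballot_Suc)
    then show ?thesis using 0 l by (simp add: dyck_sum_def)
  next
    case (Suc g)
    then have u: "u = g + 2 * i" using i by simp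
    show ?thesis
    proof (cases i)
      case 0
      then show ?thesis using Suc u by (simp add: dyck_sum_def)
    next
      case (Suc l)
      then show ?thesis using \<open>h = Suc g\<close> u
        by (simp add: dyck_sum_def ballot_Suc algebra_simps)
    qed
  qed
qed

text \<open>Sums over Motzkin paths with \<open>s\<close> steps, in which level steps have weight \<open>c\<close> and down steps weight \<open>b\<close>,
  arranged by the number \<open>u\<close> of steps that are not level.\<close>

definition motzkin_sum :: "real \<Rightarrow> real \<Rightarrow> nat \<Rightarrow> nat \<Rightarrow> real" where
  "motzkin_sum c b s h = (\<Sum>u\<le>s. real (s choose u) * c ^ (s - u) * dyck_sum b u h)"

lemma motzkin_sum_0: "motzkin_sum c b 0 h = (if h = 0 then 1 else 0)"
  by (simp add: motzkin_sum_def dyck_sum_0)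

lemma motzkin_sum_Suc:
  "motzkin_sum c b (Suc s) h = (case h of 0 \<Rightarrow> 0 | Suc g \<Rightarrow> motzkin_sum c b s g) +
     c * motzkin_sum c b s h + b * motzkin_sum c b s (Suc h)"
proof -
  have "motzkin_sum c b (Suc s) h = c ^ Suc s * dyck_sum b 0 h +
      (\<Sum>u\<le>s. real (Suc s choose Suc u) * c ^ (s - u) * dyck_sum b (Suc u) h)"
    unfolding motzkin_sum_def by (subst sum.atMost_Suc_shift) simp
  also have "\<dots> = c ^ Suc s * dyck_sum b 0 h +
      (\<Sum>u\<le>s. real (s choose Suc u) * c ^ (s - u) * dyck_sum b (Suc u) h) +
      (\<Sum>u\<le>s. real (s choose u) * c ^ (s - u) * dyck_sum b (Suc u) h)"
    by (simp add: sum.distrib[symmetric] algebra_simps)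
  also have "c ^ Suc s * dyck_sum b 0 h +
      (\<Sum>u\<le>s. real (s choose Suc u) * c ^ (s - u) * dyck_sum b (Suc u) h) =
      (\<Sum>u\<le>Suc s. real (s choose u) * c ^ (Suc s - u) * dyck_sum b u h)"
    by (subst sum.atMost_Suc_shift) simp
  also have "\<dots> = c * motzkin_sum c b s h"
    unfolding motzkin_sum_def sum_distrib_left
    by (simp add: Suc_diff_le mult_ac cong: sum.cong_simp)
  also have "(\<Sum>u\<le>s. real (s choose u) * c ^ (s - u) * dyck_sum b (Suc u) h) =
      (case h of 0 \<Rightarrow> 0 | Suc g \<Rightarrow> motzkin_sum c b s g) + b * motzkin_sum c b s (Suc h)"
    unfolding dyck_sum_Suc motzkin_sum_def
    by (cases h) (simp_all add: distrib_left sum.distrib sum_distrib_left mult_ac)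
  finally show ?thesis by simp
qed

text \<open>Two steps between odd levels amount to one Motzkin step.  The level step comes from a peak
  and a valley, of weights \<open>z2\<close> and \<open>z1\<close>; since a valley below level \<open>1\<close> is still available at level \<open>0\<close>, the weight \<open>z1 + z2\<close>
  is the same at the bottom, which would fail for the even levels.\<close>

lemma path_sum_periodic:
  assumes "\<And>i. odd i \<Longrightarrow> z i = z1" "\<And>i. even i \<Longrightarrow> i > 0 \<Longrightarrow> z i = z2"
  shows "path_sum z (Suc (2 * s)) (Suc (2 * h)) = motzkin_sum (z1 + z2) (z1 * z2) s h"
proof (induction s arbitrary: h)
  case 0
  show ?case by (simp add: motzkin_sum_0)
next
  case (Suc s)
  have z: "z (Suc (2 * h)) = z1" "z (Suc (Suc (2 * h))) = z2" "z (Suc (Suc (Suc (2 * h)))) = z1"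
    using assms by auto
  have IH': "path_sum z (Suc (2 * s)) (Suc (Suc (Suc (2 * h)))) = motzkin_sum (z1 + z2) (z1 * z2) s (Suc h)"
    using Suc[of "Suc h"] by simp
  have two: "path_sum z (Suc (2 * Suc s)) (Suc (2 * h)) =
      path_sum z (Suc (Suc (2 * s))) (2 * h) + z2 * path_sum z (Suc (Suc (2 * s))) (Suc (Suc (2 * h)))"
    using z by (simp del: path_sum.simps add: path_sum.simps(2)[of z "Suc (Suc (2 * s))"])
  have up: "path_sum z (Suc (Suc (2 * s))) (Suc (Suc (2 * h))) =
      path_sum z (Suc (2 * s)) (Suc (2 * h)) + z1 * path_sum z (Suc (2 * s)) (Suc (Suc (Suc (2 * h))))"
    using z by (simp del: path_sum.simps add: path_sum.simps(2)[of z "Suc (2 * s)"])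
  have down: "path_sum z (Suc (Suc (2 * s))) (2 * h) =
      (case h of 0 \<Rightarrow> 0 | Suc g \<Rightarrow> path_sum z (Suc (2 * s)) (Suc (2 * g))) +
      z1 * path_sum z (Suc (2 * s)) (Suc (2 * h))"
    using z by (cases h) (simp_all del: path_sum.simps add: path_sum.simps(2)[of z "Suc (2 * s)"])
  show ?case
    unfolding two up down Suc IH' motzkin_sum_Suc
    by (cases h) (simp_all add: algebra_simps)
qed

lemma moment_of_canonical_periodic:
  assumes "\<And>i. odd i \<Longrightarrow> z i = z1" "\<And>i. even i \<Longrightarrow> i > 0 \<Longrightarrow> z i = z2" and j: "j \<ge> 1"
  shows "moment_of_canonical z j =
    (\<Sum>i=0..(j - 1) div 2. real ((j - 1) choose (2 * i)) * z1 ^ (i + 1) * z2 ^ i *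
       (z1 + z2) ^ (j - 1 - 2 * i) * (1 / real (i + 1)) * real ((2 * i) choose i))"
proof -
  obtain s where s: "j = Suc s" using j by (cases j) auto
  have "moment_of_canonical z j = z1 * path_sum z (Suc (2 * s)) (Suc (2 * 0))"
    using assms(1)[of 1]
    by (simp add: s moment_of_canonical_def del: path_sum.simps)
       (simp add: path_sum.simps(2)[of z "Suc (2 * s)"] del: path_sum.simps)
  also have "\<dots> = z1 * (\<Sum>u\<le>s. real (s choose u) * (z1 + z2) ^ (s - u) * dyck_sum (z1 * z2) u 0)"
    by (subst path_sum_periodic[OF assms(1,2)]) (auto simp: motzkin_sum_def)
  also have "(\<Sum>u\<le>s. real (s choose u) * (z1 + z2) ^ (s - u) * dyck_sum (z1 * z2) u 0) =
      (\<Sum>u\<in>(\<lambda>i. 2 * i) ` {0..s div 2}. real (s choose u) * (z1 + z2) ^ (s - u) * dyck_sum (z1 * z2) u 0)"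
  proof (intro sum.mono_neutral_right ballI)
    fix u assume u: "u \<in> {..s} - (\<lambda>i. 2 * i) ` {0..s div 2}"
    have "odd u"
    proof
      assume "even u"
      then obtain i where "u = 2 * i" by (rule evenE)
      then show False using u by auto
    qed
    then show "real (s choose u) * (z1 + z2) ^ (s - u) * dyck_sum (z1 * z2) u 0 = 0"
      by (simp add: dyck_sum_def)
  qed auto
  also have "\<dots> = (\<Sum>i=0..s div 2. real (s choose (2 * i)) * (z1 + z2) ^ (s - 2 * i) *
      ((z1 * z2) ^ i * (real ((2 * i) choose i) / real (i + 1))))"
    by (subst sum.reindex) (auto simp: inj_on_def dyck_sum_def ballot_catalan)
  finally show ?thesis
    by (simp add: s sum_distrib_left power_mult_distrib mult_ac)
qed


section \<open>Moments of the Marchenko-Pastur distribution\<close>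

definition semicircle_moment :: "nat \<Rightarrow> real" where
  "semicircle_moment u = (\<integral>t. t ^ u * sqrt (1 - t\<^sup>2) * indicator {-1..1} t \<partial>lborel)"

lemma semicircle_integrable:
  "integrable lborel (\<lambda>t. t ^ u * sqrt (1 - t\<^sup>2) * indicator {-1..1::real} t)"
proof -
  have "integrable lborel (\<lambda>t. indicator {-1..1::real} t *\<^sub>R (t ^ u * sqrt (1 - t\<^sup>2)))"
    by (intro borel_integrable_compact continuous_intros) auto
  then show ?thesis by (simp add: mult_ac)
qed

text \<open>The antiderivatives below are differentiable only in the open interval, because of the square root.\<close>

lemma semicircle_FTC:
  assumes "continuous_on {-1..1} F"
    and "\<And>t. -1 < t \<Longrightarrow> t < 1 \<Longrightarrow> (F has_real_derivative f t * sqrt (1 - t\<^sup>2)) (at t)"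
    and int: "integrable lborel (\<lambda>t. f t * sqrt (1 - t\<^sup>2) * indicator {-1..1::real} t)"
  shows "(\<integral>t. f t * sqrt (1 - t\<^sup>2) * indicator {-1..1} t \<partial>lborel) = F 1 - F (-1)"
proof -
  have "((\<lambda>t. f t * sqrt (1 - t\<^sup>2)) has_integral (F 1 - F (-1))) {-1..1}"
    by (rule fundamental_theorem_of_calculus_interior)
      (use assms(1,2) in \<open>auto simp: has_real_derivative_iff_has_vector_derivative\<close>)
  moreover have "set_integrable lborel {-1..1} (\<lambda>t. f t * sqrt (1 - t\<^sup>2))"
    using int by (simp add: set_integrable_def mult_ac)
  from set_borel_integral_eq_integral(2)[OF this]
  have "(\<integral>t. f t * sqrt (1 - t\<^sup>2) * indicator {-1..1} t \<partial>lborel) =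
      integral {-1..1} (\<lambda>t. f t * sqrt (1 - t\<^sup>2))"
    by (simp add: set_lebesgue_integral_def mult_ac)
  ultimately show ?thesis by (simp add: integral_unique)
qed

lemma one_minus_square_pos: "-1 < t \<Longrightarrow> t < 1 \<Longrightarrow> 0 < 1 - t\<^sup>2" for t :: real
  by (simp add: abs_square_less_1 abs_less_iff)

lemma semicircle_moment_0: "semicircle_moment 0 = pi / 2"
proof -
  have "(\<integral>t. 1 * sqrt (1 - t\<^sup>2) * indicator {-1..1} t \<partial>lborel) =
      (1 * sqrt (1 - 1\<^sup>2) + arcsin 1) / 2 - ((-1) * sqrt (1 - (-1)\<^sup>2) + arcsin (-1)) / 2"
  proof (rule semicircle_FTC)
    show "continuous_on {-1..1} (\<lambda>t. (t * sqrt (1 - t\<^sup>2) + arcsin t) / 2)"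
      by (intro continuous_intros) auto
    fix t :: real assume t: "-1 < t" "t < 1"
    have p: "0 < 1 - t\<^sup>2" using t by (rule one_minus_square_pos)
    have "((\<lambda>t. (t * sqrt (1 - t\<^sup>2) + arcsin t) / 2) has_real_derivative
        ((sqrt (1 - t\<^sup>2) + t * (inverse (sqrt (1 - t\<^sup>2)) / 2 * (- 2 * t))) + inverse (sqrt (1 - t\<^sup>2))) / 2) (at t)"
      using t p by (auto intro!: derivative_eq_intros)
    also have "((sqrt (1 - t\<^sup>2) + t * (inverse (sqrt (1 - t\<^sup>2)) / 2 * (- 2 * t))) + inverse (sqrt (1 - t\<^sup>2))) / 2 = 1 * sqrt (1 - t\<^sup>2)"
    proof -
      define q where "q = sqrt (1 - t\<^sup>2)"
      have q: "q > 0" "t * t = 1 - q * q" using p by (auto simp: q_def power2_eq_square)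
      show ?thesis unfolding q_def[symmetric] using q by (simp add: field_simps)
    qed
    finally show "((\<lambda>t. (t * sqrt (1 - t\<^sup>2) + arcsin t) / 2) has_real_derivative
        1 * sqrt (1 - t\<^sup>2)) (at t)" .
  qed (use semicircle_integrable[of 0] in simp)
  then show ?thesis by (simp add: semicircle_moment_def)
qed

lemma semicircle_antiderivative:
  fixes t :: real
  assumes t: "-1 < t" "t < 1"
  shows "((\<lambda>t. t ^ u * ((1 - t\<^sup>2) * sqrt (1 - t\<^sup>2))) has_real_derivative
    (real u * t ^ (u - 1) - real (u + 3) * t ^ (u + 1)) * sqrt (1 - t\<^sup>2)) (at t)"
proof -
  have p: "0 < 1 - t\<^sup>2" using t by (rule one_minus_square_pos)
  define q where "q = sqrt (1 - t\<^sup>2)"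
  have q: "q > 0" "1 - t\<^sup>2 = q * q" using p by (auto simp: q_def)
  have "((\<lambda>t. t ^ u * ((1 - t\<^sup>2) * sqrt (1 - t\<^sup>2))) has_real_derivative
      real u * t ^ (u - 1) * (q * q * q) +
      t ^ u * ((- 2 * t) * q + q * q * (inverse q / 2 * (- 2 * t)))) (at t)"
    using p q(1) by (auto intro!: derivative_eq_intros simp: q_def[symmetric] q(2))
  moreover have "real u * t ^ (u - 1) * (q * q * q) +
      t ^ u * ((- 2 * t) * q + q * q * (inverse q / 2 * (- 2 * t))) =
      (real u * t ^ (u - 1) * (1 - t\<^sup>2) - 3 * t ^ (u + 1)) * q"
    unfolding q(2) using q(1) by (simp add: field_simps)
  moreover have "real u * t ^ (u - 1) * (1 - t\<^sup>2) - 3 * t ^ (u + 1) =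
      real u * t ^ (u - 1) - real (u + 3) * t ^ (u + 1)"
    by (cases u) (simp_all add: algebra_simps power2_eq_square)
  ultimately show ?thesis by (simp add: q_def)
qed

text \<open>Integrate the derivative of \<open>t\<^sup>u (1 - t\<^sup>2)\<close> times the square root, which vanishes at both end points.\<close>

lemma semicircle_moment_rec:
  "real u * semicircle_moment (u - 1) = real (u + 3) * semicircle_moment (u + 1)"
proof -
  let ?g = "\<lambda>u (t::real). t ^ u * sqrt (1 - t\<^sup>2) * indicator {-1..1} t"
  have eq: "(real u * t ^ (u - 1) - real (u + 3) * t ^ (u + 1)) * sqrt (1 - t\<^sup>2) * indicator {-1..1} t =
      real u * ?g (u - 1) t - real (u + 3) * ?g (u + 1) t" for t :: real
    by (simp add: algebra_simps)
  have "(\<integral>t. (real u * t ^ (u - 1) - real (u + 3) * t ^ (u + 1)) * sqrt (1 - t\<^sup>2) * indicator {-1..1} t \<partial>lborel) =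
      1 ^ u * ((1 - 1\<^sup>2) * sqrt (1 - 1\<^sup>2)) - (-1) ^ u * ((1 - (-1)\<^sup>2) * sqrt (1 - (-1)\<^sup>2))"
  proof (rule semicircle_FTC[where F = "\<lambda>t. t ^ u * ((1 - t\<^sup>2) * sqrt (1 - t\<^sup>2))"])
    show "continuous_on {-1..1} (\<lambda>t::real. t ^ u * ((1 - t\<^sup>2) * sqrt (1 - t\<^sup>2)))"
      by (intro continuous_intros)
    show "integrable lborel (\<lambda>t. (real u * t ^ (u - 1) - real (u + 3) * t ^ (u + 1)) * sqrt (1 - t\<^sup>2) * indicator {-1..1::real} t)"
      unfolding eq by (rule Bochner_Integration.integrable_diff; rule integrable_mult_right; rule semicircle_integrable)
  qed (rule semicircle_antiderivative)
  moreover have "(\<integral>t. (real u * t ^ (u - 1) - real (u + 3) * t ^ (u + 1)) * sqrt (1 - t\<^sup>2) * indicator {-1..1} t \<partial>lborel) =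
      real u * semicircle_moment (u - 1) - real (u + 3) * semicircle_moment (u + 1)"
    unfolding eq semicircle_moment_def
    by (subst Bochner_Integration.integral_diff; (rule integrable_mult_right, rule semicircle_integrable)?) simp
  ultimately show ?thesis by simp
qed

lemma semicircle_moment_odd: "semicircle_moment (2 * i + 1) = 0"
proof (induction i)
  case 0
  show ?case using semicircle_moment_rec[of 0] by simp
next
  case (Suc i)
  then show ?case using semicircle_moment_rec[of "2 * i + 2"] by simp
qed

lemma semicircle_moment_even:
  "semicircle_moment (2 * i) = pi / 2 / 4 ^ i * (real ((2 * i) choose i) / real (i + 1))"
proof (induction i)
  case 0
  show ?case by (simp add: semicircle_moment_0)
next
  case (Suc i)
  have c: "real (Suc i) * real ((2 * Suc i) choose Suc i) = 2 * real (2 * i + 1) * real ((2 * i) choose i)"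
  proof -
    have "Suc i * (Suc (Suc (2 * i)) choose Suc i) = Suc (Suc (2 * i)) * (Suc (2 * i) choose i)"
      by (rule Suc_times_binomial)
    moreover have "Suc i * (Suc (2 * i) choose Suc i) = Suc (2 * i) * (2 * i choose i)"
      by (rule Suc_times_binomial)
    moreover have "Suc (2 * i) choose Suc i = Suc (2 * i) choose i"
      using binomial_symmetric[of "Suc i" "Suc (2 * i)"] by simp
    ultimately have "Suc i * (Suc i * (2 * Suc i choose Suc i)) = Suc i * (2 * (2 * i + 1) * (2 * i choose i))"
      by (simp add: algebra_simps)
    then have "Suc i * (2 * Suc i choose Suc i) = 2 * (2 * i + 1) * (2 * i choose i)"
      by (simp only: mult_cancel1) simp
    then show ?thesis by (metis of_nat_mult of_nat_numeral)
  qed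
  have "real (2 * i + 1) * semicircle_moment (2 * i) = real (2 * i + 4) * semicircle_moment (2 * Suc i)"
    using semicircle_moment_rec[of "2 * i + 1"] by (simp add: algebra_simps)
  then have "semicircle_moment (2 * Suc i) = real (2 * i + 1) * semicircle_moment (2 * i) / real (2 * i + 4)"
    by (simp add: field_simps)
  also have "\<dots> = pi / 2 / 4 ^ Suc i * ((2 * real (2 * i + 1) * real ((2 * i) choose i)) / real (Suc i) / real (Suc i + 1))"
    unfolding Suc by (simp add: divide_simps) (simp add: algebra_simps)
  also have "2 * real (2 * i + 1) * real ((2 * i) choose i) / real (Suc i) = real ((2 * Suc i) choose Suc i)"
    unfolding c[symmetric] by (simp del: binomial_Suc_Suc)
  finally show ?case .
qed

lemma measurable_mp_density [measurable]: "mp_density z1 z2 \<in> borel_measurable borel"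
  unfolding mp_density_def by measurable

lemma mp_density_nonneg: "z1 \<ge> 0 \<Longrightarrow> z2 \<ge> 0 \<Longrightarrow> mp_density z1 z2 x \<ge> 0"
proof (cases "x \<in> {mp_lower z1 z2..mp_upper z1 z2}")
  case True
  have "0 \<le> mp_lower z1 z2" by (simp add: mp_lower_def)
  then have "0 \<le> x" using True by simp
  then show "z2 \<ge> 0 \<Longrightarrow> mp_density z1 z2 x \<ge> 0" using True by (simp add: mp_density_def)
qed (simp add: mp_density_def)

text \<open>Moments of positive order do not see the atom at zero, so the distribution may be replaced by
  its absolutely continuous part.\<close>

lemma marchenko_pastur_off_zero:
  assumes "z1 \<ge> 0" "z2 \<ge> 0"
  shows "density (marchenko_pastur z1 z2) (\<lambda>x. ennreal (indicator (- {0}) x)) =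
     density lborel (\<lambda>x. ennreal (indicator (- {0}) x * mp_density z1 z2 x))"
proof (rule measure_eqI)
  have [measurable_cong]: "sets (marchenko_pastur z1 z2) = sets borel" by (rule sets_marchenko_pastur)
  show "sets (density (marchenko_pastur z1 z2) (\<lambda>x. ennreal (indicator (- {0}) x))) =
     sets (density lborel (\<lambda>x. ennreal (indicator (- {0}) x * mp_density z1 z2 x)))"
    by (simp add: sets_marchenko_pastur)
  fix A assume "A \<in> sets (density (marchenko_pastur z1 z2) (\<lambda>x. ennreal (indicator (- {0}) x)))"
  then have A [measurable]: "A \<in> sets borel" by (simp add: sets_marchenko_pastur)
  have "emeasure (density (marchenko_pastur z1 z2) (\<lambda>x. ennreal (indicator (- {0}) x))) A =
      (\<integral>\<^sup>+x. ennreal (indicator (- {0}) x) * indicator A x \<partial>marchenko_pastur z1 z2)"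
    by (rule emeasure_density) (auto simp: sets_marchenko_pastur)
  also have "\<dots> = (\<integral>\<^sup>+x. indicator (A - {0}) x \<partial>marchenko_pastur z1 z2)"
    by (intro nn_integral_cong) (auto simp: indicator_def)
  also have "\<dots> = emeasure (marchenko_pastur z1 z2) (A - {0})"
    by (rule nn_integral_indicator) (simp add: sets_marchenko_pastur)
  also have "\<dots> = emeasure (density lborel (\<lambda>x. ennreal (mp_density z1 z2 x))) (A - {0})"
    by (subst emeasure_marchenko_pastur) auto
  also have "\<dots> = emeasure (density lborel (\<lambda>x. ennreal (indicator (- {0}) x * mp_density z1 z2 x))) A"
    by (simp add: emeasure_density) (auto intro!: nn_integral_cong simp: indicator_def)
  finally show "emeasure (density (marchenko_pastur z1 z2) (\<lambda>x. ennreal (indicator (- {0}) x))) A =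
     emeasure (density lborel (\<lambda>x. ennreal (indicator (- {0}) x * mp_density z1 z2 x))) A" .
qed

lemma moment_marchenko_pastur_density:
  assumes "z1 \<ge> 0" "z2 \<ge> 0" "j \<ge> 1"
  shows "moment (marchenko_pastur z1 z2) j = (\<integral>x. mp_density z1 z2 x * x ^ j \<partial>lborel)"
proof -
  have [measurable_cong]: "sets (marchenko_pastur z1 z2) = sets borel" by (rule sets_marchenko_pastur)
  have "moment (marchenko_pastur z1 z2) j =
      (\<integral>x. indicator (- {0}) x *\<^sub>R x ^ j \<partial>marchenko_pastur z1 z2)"
    unfolding moment_def using assms(3)
    by (intro Bochner_Integration.integral_cong) (auto simp: indicator_def)
  also have "\<dots> = (\<integral>x. x ^ j \<partial>density (marchenko_pastur z1 z2) (\<lambda>x. ennreal (indicator (- {0}) x)))"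
    by (subst integral_density) auto
  also have "\<dots> = (\<integral>x. (indicator (- {0}) x * mp_density z1 z2 x) *\<^sub>R x ^ j \<partial>lborel)"
    unfolding marchenko_pastur_off_zero[OF assms(1,2)]
    by (subst integral_density) (auto simp: mp_density_nonneg assms)
  also have "\<dots> = (\<integral>x. mp_density z1 z2 x * x ^ j \<partial>lborel)"
    using assms(3) by (intro Bochner_Integration.integral_cong) (auto simp: indicator_def)
  finally show ?thesis .
qed

text \<open>The affine map with centre \<open>z1 + z2\<close> and radius \<open>2 \<surd>(z1 z2)\<close> carries \<open>[-1, 1]\<close> to the support and the semicircle to
  \<open>x\<close> times the density.  The binomial theorem then reduces the moments to those of the semicircle.\<close>

lemma moment_marchenko_pastur:
  assumes z: "z1 > 0" "z2 > 0" and j: "j \<ge> 1"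
  shows "moment (marchenko_pastur z1 z2) j =
    (\<Sum>i=0..(j - 1) div 2. real ((j - 1) choose (2 * i)) * z1 ^ (i + 1) * z2 ^ i *
       (z1 + z2) ^ (j - 1 - 2 * i) * (1 / real (i + 1)) * real ((2 * i) choose i))"
proof -
  obtain s where s: "j = Suc s" using j by (cases j) auto
  define c where "c = z1 + z2"
  define r where "r = 2 * (sqrt z1 * sqrt z2)"
  have r: "r > 0" using z by (simp add: r_def)
  have r2: "r * r = 4 * (z1 * z2)" using z by (simp add: r_def real_sqrt_mult[symmetric] mult_ac)
  have lo: "mp_lower z1 z2 = c - r" and up: "mp_upper z1 z2 = c + r"
    using z by (simp_all add: mp_lower_def mp_upper_def c_def r_def power2_diff power2_sum mult_ac)
  have lo0: "mp_lower z1 z2 \<ge> 0" by (simp add: mp_lower_def)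
  have dens: "mp_density z1 z2 x * x ^ j =
      1 / (2 * pi * z2) * (x ^ s * sqrt ((x - (c - r)) * (c + r - x)) * indicator {c - r..c + r} x)" for x
  proof (cases "x = 0")
    case True
    \<comment> \<open>zero lies in the support only as its left end point, where the square root vanishes\<close>
    have "c - r = 0" if "c - r \<le> 0" using that lo lo0 by linarith
    then show ?thesis using True by (auto simp: s indicator_def)
  next
    case False
    then show ?thesis by (simp add: mp_density_def lo up s mult_ac)
  qed
  have subst: "(x ^ s * sqrt ((x - (c - r)) * (c + r - x)) * indicator {c - r..c + r} x) =
      r * (\<Sum>u\<le>s. real (s choose u) * r ^ u * c ^ (s - u) * (t ^ u * sqrt (1 - t\<^sup>2) * indicator {-1..1} t))"
    if x: "x = c + r * t" for x t
  proof -
    have "(x - (c - r)) * (c + r - x) = r\<^sup>2 * (1 - t\<^sup>2)"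
      unfolding x by (simp add: power2_eq_square algebra_simps)
    then have "sqrt ((x - (c - r)) * (c + r - x)) = r * sqrt (1 - t\<^sup>2)"
      using r by (simp add: real_sqrt_mult)
    moreover have "(indicator {c - r..c + r} x :: real) = indicator {-1..1} t"
    proof -
      have "c - r \<le> c + r * t \<longleftrightarrow> r * (-1) \<le> r * t" by auto
      moreover have "c + r * t \<le> c + r \<longleftrightarrow> r * t \<le> r * 1" by auto
      ultimately show ?thesis
        unfolding x indicator_def atLeastAtMost_iff using r by (simp only: mult_le_cancel_left_pos)
    qed
    moreover have "x ^ s = (\<Sum>u\<le>s. real (s choose u) * r ^ u * c ^ (s - u) * t ^ u)"
      unfolding x add.commute[of c] binomial_ring by (simp add: power_mult_distrib mult_ac)
    ultimately show ?thesis
      by (simp add: sum_distrib_left sum_distrib_right mult_ac)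
  qed
  have "moment (marchenko_pastur z1 z2) j =
      1 / (2 * pi * z2) * (\<integral>x. x ^ s * sqrt ((x - (c - r)) * (c + r - x)) * indicator {c - r..c + r} x \<partial>lborel)"
    using z j by (simp add: moment_marchenko_pastur_density dens del: power_Suc)
  also have "(\<integral>x. x ^ s * sqrt ((x - (c - r)) * (c + r - x)) * indicator {c - r..c + r} x \<partial>lborel) =
      r * (\<integral>t. r * (\<Sum>u\<le>s. real (s choose u) * r ^ u * c ^ (s - u) * (t ^ u * sqrt (1 - t\<^sup>2) * indicator {-1..1} t)) \<partial>lborel)"
    unfolding subst[OF refl, symmetric] using r
    by (subst lborel_integral_real_affine[where c = r and t = c]) simp_all
  also have "\<dots> = r * r * (\<Sum>u\<le>s. real (s choose u) * r ^ u * c ^ (s - u) * semicircle_moment u)"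
    unfolding semicircle_moment_def
    by (simp add: Bochner_Integration.integral_sum semicircle_integrable)
  also have "(\<Sum>u\<le>s. real (s choose u) * r ^ u * c ^ (s - u) * semicircle_moment u) =
      (\<Sum>u\<in>(\<lambda>i. 2 * i) ` {0..s div 2}. real (s choose u) * r ^ u * c ^ (s - u) * semicircle_moment u)"
  proof (intro sum.mono_neutral_right ballI)
    fix u assume u: "u \<in> {..s} - (\<lambda>i. 2 * i) ` {0..s div 2}"
    have "odd u"
    proof
      assume "even u"
      then obtain i where "u = 2 * i" by (rule evenE)
      then show False using u by auto
    qed
    then obtain i where "u = 2 * i + 1" by (rule oddE)
    then show "real (s choose u) * r ^ u * c ^ (s - u) * semicircle_moment u = 0"
      using semicircle_moment_odd by simp
  qed auto
  also have "\<dots> = (\<Sum>i=0..s div 2. real (s choose (2 * i)) * r ^ (2 * i) * c ^ (s - 2 * i) * semicircle_moment (2 * i))"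
    by (subst sum.reindex) (auto simp: inj_on_def)
  also have "\<dots> = (\<Sum>i=0..s div 2. pi / 2 * (real (s choose (2 * i)) * z1 ^ i * z2 ^ i * c ^ (s - 2 * i) *
      (1 / real (i + 1)) * real ((2 * i) choose i)))"
    unfolding power_mult power2_eq_square r2 semicircle_moment_even
    by (intro sum.cong refl) (simp add: power_mult_distrib)
  also have "1 / (2 * pi * z2) * (r * r * (\<Sum>i=0..s div 2. pi / 2 * (real (s choose (2 * i)) * z1 ^ i * z2 ^ i * c ^ (s - 2 * i) *
      (1 / real (i + 1)) * real ((2 * i) choose i)))) =
      z1 * (\<Sum>i=0..s div 2. real (s choose (2 * i)) * z1 ^ i * z2 ^ i * c ^ (s - 2 * i) *
      (1 / real (i + 1)) * real ((2 * i) choose i))"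
    unfolding r2 sum_distrib_left[symmetric] using z by (simp add: field_simps)
  finally show ?thesis
    by (simp add: s c_def sum_distrib_left mult_ac)
qed


section \<open>The random moment vector\<close>

definition potential_at :: "(real \<Rightarrow> real) \<Rightarrow> (real \<Rightarrow> real) \<Rightarrow> nat \<Rightarrow> real \<Rightarrow> real" where
  "potential_at V1 V2 i = (if odd i then V1 else V2)"

lemma sum_potential_at:
  "(\<Sum>j=1..(n + 1) div 2. V1 (z (2 * j - 1))) + (\<Sum>j=1..n div 2. V2 (z (2 * j))) =
   (\<Sum>i=1..n. potential_at V1 V2 i (z i))"
proof (induction n)
  case (Suc n)
  show ?case
  proof (cases "even n")
    case True
    then obtain m where m: "n = 2 * m" by auto
    show ?thesis using Suc by (simp add: m potential_at_def)
  next
    case False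
    then obtain m where m: "n = 2 * m + 1" by (auto elim: oddE)
    show ?thesis using Suc by (simp add: m potential_at_def)
  qed
qed simp

lemma moment_weight_eq:
  "moment_weight V1 V2 n m = indicator (canonical_domain n) m *
     (\<Prod>i=1..n. exp (- real n * potential_at V1 V2 i (canonical_of_moments m n i)))"
proof (cases "m \<in> canonical_domain n")
  case True
  have "(\<Sum>j=1..(n + 1) div 2. V1 (canonical_moment m (2 * j - 1))) =
      (\<Sum>j=1..(n + 1) div 2. V1 (canonical_of_moments m n (2 * j - 1)))"
    using canonical_moment_eq[OF True] by (intro sum.cong refl) auto
  moreover have "(\<Sum>j=1..n div 2. V2 (canonical_moment m (2 * j))) =
      (\<Sum>j=1..n div 2. V2 (canonical_of_moments m n (2 * j)))"
    using canonical_moment_eq[OF True] by (intro sum.cong refl) auto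
  ultimately have "moment_weight V1 V2 n m = exp (- real n *
      ((\<Sum>j=1..(n + 1) div 2. V1 (canonical_of_moments m n (2 * j - 1))) +
       (\<Sum>j=1..n div 2. V2 (canonical_of_moments m n (2 * j)))))"
    using True by (simp add: moment_weight_def moment_space_interior_eq algebra_simps)
  also have "\<dots> = (\<Prod>i=1..n. exp (- real n * potential_at V1 V2 i (canonical_of_moments m n i)))"
    unfolding sum_potential_at sum_distrib_left by (simp add: exp_sum)
  finally show ?thesis using True by simp
qed (simp add: moment_weight_def moment_space_interior_eq)

lemma path_sum_nonneg: "(\<And>i. z i \<ge> 0) \<Longrightarrow> path_sum z t h \<ge> 0"
  by (induction t arbitrary: h) (auto split: nat.splits)

lemma prod_mono_ennreal:
  "(\<And>i. i \<in> A \<Longrightarrow> f i \<le> g i) \<Longrightarrow> prod f A \<le> prod g A" for f g :: "_ \<Rightarrow> ennreal"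
  by (induction A rule: infinite_finite_induct) (auto intro!: mult_mono)

locale random_moments = prob_space \<Omega> for \<Omega> :: "'a measure" +
  fixes V1 V2 :: "real \<Rightarrow> real" and \<epsilon> z1 z2 :: real and X :: "nat \<Rightarrow> nat \<Rightarrow> 'a \<Rightarrow> real"
  assumes \<epsilon>: "\<epsilon> > 0"
    and V1: "admissible_potential \<epsilon> V1" and V2: "admissible_potential \<epsilon> V2"
    and min1: "unique_minimizer_on (\<lambda>z. V1 z - ln z) {0<..} z1"
    and min2: "unique_minimizer_on (\<lambda>z. V2 z - ln z) {0<..} z2"
    and X_measurable: "\<And>n j. 1 \<le> j \<Longrightarrow> j \<le> n \<Longrightarrow> X n j \<in> borel_measurable \<Omega>"
    and X_law: "\<And>n. 1 \<le> n \<Longrightarrow>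
      distr \<Omega> (lebesgue_prod n) (\<lambda>\<omega>. \<lambda>j\<in>{1..n}. X n j \<omega>) = moment_law V1 V2 n"
begin

abbreviation V :: "nat \<Rightarrow> real \<Rightarrow> real" where
  "V \<equiv> potential_at V1 V2"

definition minimizer :: "nat \<Rightarrow> real" where
  "minimizer i = (if odd i then z1 else z2)"

abbreviation J :: "nat \<Rightarrow> nat \<Rightarrow> (real \<Rightarrow> ennreal) \<Rightarrow> ennreal" where
  "J n i \<equiv> canonical_weight_integral (V i) n i"

definition Z :: "nat \<Rightarrow> 'a \<Rightarrow> nat \<Rightarrow> real" where
  "Z n \<omega> = canonical_of_moments (\<lambda>j. X n j \<omega>) n"

text \<open>The expectation of \<open>f(z\<^sub>i)\<close>; see \<open>canonical_marginal\<close>.\<close>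

definition coordinate_mean :: "nat \<Rightarrow> nat \<Rightarrow> (real \<Rightarrow> ennreal) \<Rightarrow> ennreal" where
  "coordinate_mean n i f = J n i f * inverse (J n i (\<lambda>_. 1))"

lemma V_admissible: "admissible_potential \<epsilon> (V i)"
  using V1 V2 by (simp add: potential_at_def)

lemma V_minimizer: "unique_minimizer_on (\<lambda>z. V i z - ln z) {0<..} (minimizer i)"
  using min1 min2 by (simp add: potential_at_def minimizer_def)

lemma minimizer_pos: "minimizer i > 0"
  using V_minimizer[of i] unfolding unique_minimizer_on_def is_arg_min_def by auto

lemma J_one:
  assumes "1 \<le> i" "i \<le> n"
  obtains a where "a > 0" "J n i (\<lambda>_. 1) = ennreal a"
proof -
  obtain c where c: "c > 0" "\<And>n. i \<le> n \<Longrightarrow>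
      ennreal (c * exp (- real n * (V i (minimizer i) - ln (minimizer i) + 1))) \<le> J n i (\<lambda>_. 1)"
    using canonical_weight_integral_lower[OF V_admissible minimizer_pos zero_less_one] by blast
  have "J n i (\<lambda>_. 1) < \<infinity>"
    using canonical_weight_integral_finite[OF \<epsilon> V_admissible assms, of 0] by simp
  then obtain a where a: "J n i (\<lambda>_. 1) = ennreal a" "a \<ge> 0"
    by (cases "J n i (\<lambda>_. 1)") auto
  have "0 < c * exp (- real n * (V i (minimizer i) - ln (minimizer i) + 1))" using c by simp
  also have "\<dots> \<le> a" using c(2)[OF assms(2)] a by (simp add: ennreal_le_iff)
  finally show thesis using a(1) that by blast
qed

lemma coordinate_mean_one: "1 \<le> i \<Longrightarrow> i \<le> n \<Longrightarrow> coordinate_mean n i (\<lambda>_. 1) = 1"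
  by (erule (1) J_one) (simp add: coordinate_mean_def inverse_ennreal ennreal_mult[symmetric])

lemma X_vector_measurable:
  "(\<lambda>\<omega>. \<lambda>j\<in>{1..n}. X n j \<omega>) \<in> measurable \<Omega> (lebesgue_prod n)"
  unfolding lebesgue_prod_def by (intro measurable_restrict) (use X_measurable in auto)

lemma Z_eq: "Z n \<omega> = canonical_of_moments (\<lambda>j\<in>{1..n}. X n j \<omega>) n"
  unfolding Z_def by (rule canonical_of_moments_cong) simp

lemma Z_measurable [measurable]: "(\<lambda>\<omega>. Z n \<omega> i) \<in> borel_measurable \<Omega>"
  unfolding Z_eq
  by (rule measurable_compose[OF X_vector_measurable measurable_canonical_of_moments]) simp

lemma moment_weight_measurable: "moment_weight V1 V2 n \<in> borel_measurable (lebesgue_prod n)"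
proof -
  note [measurable] = admissible_measurable[OF V_admissible]
    measurable_canonical_of_moments[OF order.refl[of n]] sets_canonical_domain
  have "moment_weight V1 V2 n = (\<lambda>m. indicator (canonical_domain n) m *
      (\<Prod>i=1..n. indicator {0<..} (canonical_of_moments m n i) *
        exp (- real n * V i (canonical_of_moments m n i))))"
  proof
    fix m
    show "moment_weight V1 V2 n m = indicator (canonical_domain n) m *
        (\<Prod>i=1..n. indicator {0<..} (canonical_of_moments m n i) *
          exp (- real n * V i (canonical_of_moments m n i)))"
      unfolding moment_weight_eq
      by (cases "m \<in> canonical_domain n") (auto simp: canonical_domain_def intro!: prod.cong)
  qed
  also have "\<dots> \<in> borel_measurable (lebesgue_prod n)"
    by (intro borel_measurable_times borel_measurable_indicator sets_canonical_domain
        borel_measurable_prod measurable_compose[OF measurable_canonical_of_moments[OF order.refl]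
          admissible_measurable[OF V_admissible]])
  finally show ?thesis .
qed

lemma nn_integral_moment_weight:
  assumes [measurable]: "\<And>i. f i \<in> borel_measurable borel"
  shows "(\<integral>\<^sup>+m. (\<Prod>i=1..n. f i (canonical_of_moments m n i)) * ennreal (moment_weight V1 V2 n m)
     \<partial>lebesgue_prod n) = (\<Prod>i=1..n. J n i (f i))"
proof -
  \<comment> \<open>the potential is controlled on the positive half line only, so measurability needs the cut-off\<close>
  define g where "g i t = f i t * ennreal (indicator {0<..} t * exp (- real n * V i t))" for i t
  have g: "g i \<in> borel_measurable borel" for i
    unfolding g_def using admissible_measurable[OF V_admissible, of "real n" i] by measurable
  have "(\<integral>\<^sup>+m. (\<Prod>i=1..n. f i (canonical_of_moments m n i)) * ennreal (moment_weight V1 V2 n m)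
     \<partial>lebesgue_prod n) = (\<integral>\<^sup>+m. (\<Prod>i=1..n. g i (canonical_of_moments m n i)) *
        indicator (canonical_domain n) m \<partial>lebesgue_prod n)"
  proof (intro nn_integral_cong)
    fix m
    show "(\<Prod>i=1..n. f i (canonical_of_moments m n i)) * ennreal (moment_weight V1 V2 n m) =
        (\<Prod>i=1..n. g i (canonical_of_moments m n i)) * indicator (canonical_domain n) m"
    proof (cases "m \<in> canonical_domain n")
      case True
      have "ennreal (\<Prod>i=1..n. exp (- real n * V i (canonical_of_moments m n i))) =
          (\<Prod>i=1..n. ennreal (exp (- real n * V i (canonical_of_moments m n i))))"
        by (rule prod_ennreal[symmetric]) simp
      moreover have "(\<Prod>i=1..n. g i (canonical_of_moments m n i)) =
          (\<Prod>i=1..n. f i (canonical_of_moments m n i) * ennreal (exp (- real n * V i (canonical_of_moments m n i))))"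
        using True by (intro prod.cong) (auto simp: g_def canonical_domain_def)
      ultimately show ?thesis using True by (simp add: moment_weight_eq prod.distrib)
    qed (simp add: moment_weight_eq)
  qed
  also have "\<dots> = (\<Prod>i=1..n. \<integral>\<^sup>+t. g i t * ennreal (t ^ (n - i)) * indicator {0<..} t \<partial>lborel)"
    by (rule nn_integral_canonical[OF g])
  also have "\<dots> = (\<Prod>i=1..n. J n i (f i))"
  proof (intro prod.cong refl)
    fix i
    show "(\<integral>\<^sup>+t. g i t * ennreal (t ^ (n - i)) * indicator {0<..} t \<partial>lborel) = J n i (f i)"
      unfolding canonical_weight_integral_def g_def
      by (intro nn_integral_cong) (auto simp: indicator_def ennreal_mult mult_ac)
  qed
  finally show ?thesis .
qed

lemma moment_partition_eq: "moment_partition V1 V2 n = (\<Prod>i=1..n. J n i (\<lambda>_. 1))"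
  using nn_integral_moment_weight[of "\<lambda>_ _. 1" n] by (simp add: moment_partition_def)

text \<open>Independence of the canonical moments: the expectation of a product is a product of one-dimensional
  quotients.\<close>

lemma canonical_law:
  assumes [measurable]: "\<And>i. f i \<in> borel_measurable borel" and n: "1 \<le> n"
  shows "(\<integral>\<^sup>+\<omega>. (\<Prod>i=1..n. f i (Z n \<omega> i)) \<partial>\<Omega>) = (\<Prod>i=1..n. coordinate_mean n i (f i))"
proof -
  let ?F = "\<lambda>m. \<Prod>i=1..n. f i (canonical_of_moments m n i)"
  let ?c = "moment_partition V1 V2 n"
  note [measurable] = measurable_canonical_of_moments[OF order.refl[of n]] moment_weight_measurable
  have F: "?F \<in> borel_measurable (lebesgue_prod n)" by measurable
  have "\<forall>i. \<exists>a. 1 \<le> i \<longrightarrow> i \<le> n \<longrightarrow> a > 0 \<and> J n i (\<lambda>_. 1) = ennreal a"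
    using J_one by metis
  then obtain a where a: "\<And>i. 1 \<le> i \<Longrightarrow> i \<le> n \<Longrightarrow> a i > 0"
    "\<And>i. 1 \<le> i \<Longrightarrow> i \<le> n \<Longrightarrow> J n i (\<lambda>_. 1) = ennreal (a i)" by metis
  have "?c = (\<Prod>i=1..n. ennreal (a i))"
    unfolding moment_partition_eq using a by (intro prod.cong) auto
  also have "\<dots> = ennreal (\<Prod>i=1..n. a i)"
    using a by (intro prod_ennreal) (auto intro: less_imp_le)
  finally have "?c = ennreal (\<Prod>i=1..n. a i)" .
  moreover have "(\<Prod>i=1..n. a i) > 0" using a by (intro prod_pos) auto
  ultimately have "inverse ?c = ennreal (inverse (\<Prod>i=1..n. a i))"
    by (simp only: inverse_ennreal)
  also have "\<dots> = (\<Prod>i=1..n. ennreal (inverse (a i)))"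
    using a by (subst prod_ennreal) (auto intro: less_imp_le simp: prod_inversef[symmetric] comp_def)
  also have "\<dots> = (\<Prod>i=1..n. inverse (J n i (\<lambda>_. 1)))"
    using a by (intro prod.cong) (auto simp: inverse_ennreal)
  finally have c: "inverse ?c = (\<Prod>i=1..n. inverse (J n i (\<lambda>_. 1)))" .
  have "(\<integral>\<^sup>+\<omega>. (\<Prod>i=1..n. f i (Z n \<omega> i)) \<partial>\<Omega>) =
      (\<integral>\<^sup>+m. ?F m \<partial>distr \<Omega> (lebesgue_prod n) (\<lambda>\<omega>. \<lambda>j\<in>{1..n}. X n j \<omega>))"
    unfolding Z_eq by (rule nn_integral_distr[OF X_vector_measurable, symmetric]) (use F in simp)
  also have "\<dots> = (\<integral>\<^sup>+m. ennreal (moment_weight V1 V2 n m) / ?c * ?F m \<partial>lebesgue_prod n)"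
    unfolding X_law[OF n] moment_law_def by (rule nn_integral_density) measurable
  also have "\<dots> = (\<integral>\<^sup>+m. ?F m * ennreal (moment_weight V1 V2 n m) * inverse ?c \<partial>lebesgue_prod n)"
    by (simp add: divide_ennreal_def mult_ac)
  also have "\<dots> = (\<Prod>i=1..n. J n i (f i)) * inverse ?c"
  proof -
    have m: "(\<lambda>m. ?F m * ennreal (moment_weight V1 V2 n m)) \<in> borel_measurable (lebesgue_prod n)"
      by measurable
    show ?thesis by (simp only: nn_integral_multc[OF m] nn_integral_moment_weight[OF assms(1)])
  qed
  finally show ?thesis unfolding c coordinate_mean_def prod.distrib .
qed

lemma canonical_marginal:
  assumes [measurable]: "f \<in> borel_measurable borel" and i: "1 \<le> i" "i \<le> n"
  shows "(\<integral>\<^sup>+\<omega>. f (Z n \<omega> i) \<partial>\<Omega>) = coordinate_mean n i f"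
proof -
  have "(\<integral>\<^sup>+\<omega>. f (Z n \<omega> i) \<partial>\<Omega>) =
      (\<integral>\<^sup>+\<omega>. (\<Prod>l=1..n. (if l = i then f else (\<lambda>_. 1)) (Z n \<omega> l)) \<partial>\<Omega>)"
    using i by (simp add: if_distrib[of "\<lambda>f. f _"] cong: if_cong)
  also have "\<dots> = (\<Prod>l=1..n. coordinate_mean n l (if l = i then f else (\<lambda>_. 1)))"
    using i by (intro canonical_law) auto
  also have "\<dots> = (\<Prod>l=1..n. if l = i then coordinate_mean n i f else 1)"
    by (intro prod.cong refl) (auto simp: coordinate_mean_one)
  finally show ?thesis using i by simp
qed

lemma AE_canonical_domain:
  assumes n: "1 \<le> n"
  shows "AE \<omega> in \<Omega>. (\<lambda>j\<in>{1..n}. X n j \<omega>) \<in> canonical_domain n"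
proof (rule AE_distrD[OF X_vector_measurable])
  have "(\<lambda>m. ennreal (moment_weight V1 V2 n m) / moment_partition V1 V2 n)
      \<in> borel_measurable (lebesgue_prod n)"
    using moment_weight_measurable by measurable
  then have "AE m in density (lebesgue_prod n)
     (\<lambda>m. ennreal (moment_weight V1 V2 n m) / moment_partition V1 V2 n). m \<in> canonical_domain n"
    by (simp only: AE_density) (auto simp: moment_weight_eq indicator_def)
  then show "AE m in distr \<Omega> (lebesgue_prod n) (\<lambda>\<omega>. \<lambda>j\<in>{1..n}. X n j \<omega>). m \<in> canonical_domain n"
    unfolding X_law[OF n] moment_law_def .
qed

lemma AE_moments:
  assumes "1 \<le> n"
  shows "AE \<omega> in \<Omega>. (\<forall>i. Z n \<omega> i > 0) \<and> (\<forall>j\<in>{1..n}. X n j \<omega> = moment_of_canonical (Z n \<omega>) j)"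
  using AE_canonical_domain[OF assms]
proof eventually_elim
  case (elim \<omega>)
  then have pos: "\<forall>i\<in>{1..n}. canonical_of_moments (\<lambda>j\<in>{1..n}. X n j \<omega>) n i > 0"
    by (simp add: canonical_domain_def)
  show ?case
    unfolding Z_eq using canonical_of_moments_pos[OF pos] moment_of_canonical_of_moments[OF pos] by auto
qed

lemma coordinate_mean_concentration:
  assumes \<delta>: "\<delta> > 0" and i: "1 \<le> i"
  obtains C \<eta> n0 where "C \<ge> 0" "\<eta> > 0" "n0 \<ge> i"
    "\<And>n. n \<ge> n0 \<Longrightarrow> coordinate_mean n i (\<lambda>t. ennreal (t ^ p) * indicator {t. \<bar>t - minimizer i\<bar> \<ge> \<delta>} t)
       \<le> ennreal (C * exp (- \<eta> * real n))"
proof -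
  obtain C \<eta> n0 where C: "C \<ge> 0" "\<eta> > 0" "\<And>n. n \<ge> n0 \<Longrightarrow>
      J n i (\<lambda>t. ennreal (t ^ p) * indicator {t. \<bar>t - minimizer i\<bar> \<ge> \<delta>} t) \<le>
      ennreal (C * exp (- \<eta> * real n)) * J n i (\<lambda>_. 1)"
    by (rule canonical_weight_integral_concentration[OF \<epsilon> V_admissible[of i] V_minimizer \<delta> i, where p = p])
      (rule that; blast)
  show thesis
  proof (rule that[of C \<eta> "max n0 i"])
    fix n assume n: "n \<ge> max n0 i"
    have "coordinate_mean n i (\<lambda>t. ennreal (t ^ p) * indicator {t. \<bar>t - minimizer i\<bar> \<ge> \<delta>} t) \<le>
        ennreal (C * exp (- \<eta> * real n)) * J n i (\<lambda>_. 1) * inverse (J n i (\<lambda>_. 1))"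
      unfolding coordinate_mean_def using C(3)[of n] n by (intro mult_right_mono) auto
    also have "\<dots> = ennreal (C * exp (- \<eta> * real n)) * coordinate_mean n i (\<lambda>_. 1)"
      by (simp add: coordinate_mean_def mult.assoc)
    finally show "coordinate_mean n i (\<lambda>t. ennreal (t ^ p) * indicator {t. \<bar>t - minimizer i\<bar> \<ge> \<delta>} t) \<le>
        ennreal (C * exp (- \<eta> * real n))"
      using i n by (simp add: coordinate_mean_one)
  qed (use C in auto)
qed

lemma AE_Z_close:
  assumes \<delta>: "\<delta> > 0" and i: "1 \<le> i"
  shows "AE \<omega> in \<Omega>. \<forall>\<^sub>F n in sequentially. \<bar>Z n \<omega> i - minimizer i\<bar> < \<delta>"
proof -
  define A where "A n = {\<omega> \<in> space \<Omega>. \<bar>Z n \<omega> i - minimizer i\<bar> \<ge> \<delta>}" for n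
  have A [measurable]: "A n \<in> sets \<Omega>" for n unfolding A_def by measurable
  obtain C \<eta> n0 where C: "C \<ge> 0" "\<eta> > 0" "n0 \<ge> i" "\<And>n. n \<ge> n0 \<Longrightarrow>
      coordinate_mean n i (\<lambda>t. ennreal (t ^ 0) * indicator {t. \<bar>t - minimizer i\<bar> \<ge> \<delta>} t)
       \<le> ennreal (C * exp (- \<eta> * real n))"
    by (rule coordinate_mean_concentration[OF \<delta> i, where p = 0]) (rule that; blast)
  have le: "measure \<Omega> (A n) \<le> C * exp (- \<eta>) ^ n" if n: "n \<ge> n0" for n
  proof -
    have "emeasure \<Omega> (A n) = (\<integral>\<^sup>+\<omega>. indicator (A n) \<omega> \<partial>\<Omega>)" by simp
    also have "\<dots> = (\<integral>\<^sup>+\<omega>. indicator {t. \<bar>t - minimizer i\<bar> \<ge> \<delta>} (Z n \<omega> i) \<partial>\<Omega>)"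
      by (intro nn_integral_cong) (auto simp: A_def indicator_def)
    also have "\<dots> = coordinate_mean n i (indicator {t. \<bar>t - minimizer i\<bar> \<ge> \<delta>})"
      using i n C(3) by (intro canonical_marginal) auto
    also have "\<dots> \<le> ennreal (C * exp (- \<eta> * real n))" using C(4)[OF n] by simp
    finally show ?thesis
      using C(1) by (simp add: emeasure_eq_measure ennreal_le_iff exp_of_nat_mult[symmetric] mult.commute)
  qed
  have "summable (\<lambda>n. C * exp (- \<eta>) ^ n)"
    using C(2) by (intro summable_mult summable_geometric) simp
  from summable_comparison_test'[OF this, of n0 "\<lambda>n. measure \<Omega> (A n)"] le
  have "summable (\<lambda>n. measure \<Omega> (A n))" by simp
  from borel_cantelli_AE1[OF A _ this] have "AE \<omega> in \<Omega>. \<forall>\<^sub>F n in sequentially. \<omega> \<in> space \<Omega> - A n"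
    by (simp add: emeasure_eq_measure)
  then show ?thesis
    by eventually_elim (auto simp: A_def not_le elim: eventually_mono)
qed

lemma AE_Z_tendsto:
  "AE \<omega> in \<Omega>. \<forall>i\<ge>1. (\<lambda>n. Z n \<omega> i) \<longlonglongrightarrow> minimizer i"
proof -
  have "AE \<omega> in \<Omega>. \<forall>i m. 1 \<le> i \<longrightarrow> (\<forall>\<^sub>F n in sequentially. \<bar>Z n \<omega> i - minimizer i\<bar> < inverse (real (Suc m)))"
    unfolding AE_all_countable by (intro allI AE_impI AE_Z_close) auto
  then show ?thesis
  proof eventually_elim
    case (elim \<omega>)
    show ?case
    proof (intro allI impI tendstoI)
      fix i :: nat and e :: real assume i: "1 \<le> i" and "e > 0"
      then obtain m where m: "inverse (real (Suc m)) < e" using reals_Archimedean by blast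
      from elim i have "\<forall>\<^sub>F n in sequentially. \<bar>Z n \<omega> i - minimizer i\<bar> < inverse (real (Suc m))"
        by blast
      then show "\<forall>\<^sub>F n in sequentially. dist (Z n \<omega> i) (minimizer i) < e"
        using m by (auto simp: dist_real_def elim: eventually_mono)
    qed
  qed
qed

text \<open>The moments are polynomials in the canonical moments, so they inherit almost sure convergence.\<close>

lemma AE_X_tendsto:
  "AE \<omega> in \<Omega>. \<forall>j\<ge>1. (\<lambda>n. X n j \<omega>) \<longlonglongrightarrow> moment_of_canonical minimizer j"
proof -
  have "AE \<omega> in \<Omega>. \<forall>n. 1 \<le> n \<longrightarrow> (\<forall>i. Z n \<omega> i > 0) \<and> (\<forall>j\<in>{1..n}. X n j \<omega> = moment_of_canonical (Z n \<omega>) j)"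
    unfolding AE_all_countable by (intro allI AE_impI AE_moments)
  with AE_Z_tendsto show ?thesis
  proof eventually_elim
    case (elim \<omega>)
    have lim: "(\<lambda>n. path_sum (Z n \<omega>) t h) \<longlonglongrightarrow> path_sum minimizer t h" for t h
    proof (induction t arbitrary: h)
      case (Suc t)
      have "(\<lambda>n. Z n \<omega> (Suc h)) \<longlonglongrightarrow> minimizer (Suc h)" using elim(1) by simp
      then show ?case using Suc by (cases h) (auto intro!: tendsto_intros)
    qed simp
    show ?case
    proof (intro allI impI)
      fix j :: nat assume j: "1 \<le> j"
      have "\<forall>\<^sub>F n in sequentially. moment_of_canonical (Z n \<omega>) j = X n j \<omega>"
        using elim(2) j by (intro eventually_sequentiallyI[of j]) auto
      moreover have "(\<lambda>n. moment_of_canonical (Z n \<omega>) j) \<longlonglongrightarrow> moment_of_canonical minimizer j"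
        unfolding moment_of_canonical_def by (rule lim)
      ultimately show "(\<lambda>n. X n j \<omega>) \<longlonglongrightarrow> moment_of_canonical minimizer j"
        by (rule Lim_transform_eventually[rotated])
    qed
  qed
qed

text \<open>If \<open>B\<^sub>i\<^sup>p\<close> bounds the \<open>p\<close>-th moment of every \<open>z\<^sub>i\<close>, then replacing \<open>z\<close> by \<open>B\<close> bounds the expectation of every
  monomial by independence, hence also of every path sum.  The induction unfolds the path sum and collects the
  weights of the steps in the exponents \<open>p\<close>.  A path from \<open>0\<close> to \<open>h\<close> with \<open>t\<close> steps goes down \<open>(t - h)/2\<close> times,
  so the hypothesis on \<open>2 p\<^sub>i + t\<close> says that no exponent will exceed \<open>j\<close>.\<close>

lemma mean_path_sum_le:
  assumes B: "\<And>i. B i \<ge> 0" and n: "1 \<le> n" "j \<le> n"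
    and mean: "\<And>i p. i \<in> {1..j} \<Longrightarrow> p \<le> j \<Longrightarrow> coordinate_mean n i (\<lambda>t. ennreal (t ^ p)) \<le> ennreal (B i ^ p)"
    and p: "\<And>i. i \<notin> {1..j} \<Longrightarrow> p i = 0" "\<And>i. i \<in> {1..j} \<Longrightarrow> 2 * p i + t \<le> 2 * j + h" and th: "t + h \<le> 2 * j"
  shows "(\<integral>\<^sup>+\<omega>. ennreal ((\<Prod>i=1..n. Z n \<omega> i ^ p i) * path_sum (Z n \<omega>) t h) \<partial>\<Omega>) \<le>
    ennreal ((\<Prod>i=1..n. B i ^ p i) * path_sum B t h)"
  using p th
proof (induction t arbitrary: p h)
  case 0
  show ?case
  proof (cases "h = 0")
    case True
    have "(\<integral>\<^sup>+\<omega>. ennreal (\<Prod>i=1..n. Z n \<omega> i ^ p i) \<partial>\<Omega>) = (\<integral>\<^sup>+\<omega>. (\<Prod>i=1..n. ennreal (Z n \<omega> i ^ p i)) \<partial>\<Omega>)"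
    proof (rule nn_integral_cong_AE)
      show "AE \<omega> in \<Omega>. ennreal (\<Prod>i=1..n. Z n \<omega> i ^ p i) = (\<Prod>i=1..n. ennreal (Z n \<omega> i ^ p i))"
        using AE_moments[OF n(1)]
        by eventually_elim (subst prod_ennreal, auto intro!: zero_le_power less_imp_le)
    qed
    also have "\<dots> = (\<Prod>i=1..n. coordinate_mean n i (\<lambda>t. ennreal (t ^ p i)))"
      by (rule canonical_law[where f = "\<lambda>i t. ennreal (t ^ p i)"]) (use n in auto)
    also have "\<dots> \<le> (\<Prod>i=1..n. ennreal (B i ^ p i))"
    proof (rule prod_mono_ennreal)
      fix i assume i: "i \<in> {1..n}"
      show "coordinate_mean n i (\<lambda>t. ennreal (t ^ p i)) \<le> ennreal (B i ^ p i)"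
      proof (cases "i \<in> {1..j}")
        case True
        then show ?thesis using 0(2)[OF True] \<open>h = 0\<close> by (intro mean) auto
      next
        case False
        then show ?thesis using 0(1)[OF False] i by (simp add: coordinate_mean_one)
      qed
    qed
    also have "\<dots> = ennreal (\<Prod>i=1..n. B i ^ p i)" using B by (intro prod_ennreal) auto
    finally show ?thesis using True by simp
  qed simp
next
  case (Suc t)
  let ?m = "\<lambda>z. \<Prod>i=1..n. z i ^ p i"
  have nonneg: "AE \<omega> in \<Omega>. \<forall>i. Z n \<omega> i \<ge> 0"
    using AE_moments[OF n(1)] by eventually_elim (auto intro: less_imp_le)
  have up: "(\<integral>\<^sup>+\<omega>. ennreal (?m (Z n \<omega>) * (case h of 0 \<Rightarrow> 0 | Suc g \<Rightarrow> path_sum (Z n \<omega>) t g)) \<partial>\<Omega>) \<le>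
      ennreal (?m B * (case h of 0 \<Rightarrow> 0 | Suc g \<Rightarrow> path_sum B t g))"
  proof (cases h)
    case (Suc g)
    have "(\<integral>\<^sup>+\<omega>. ennreal (?m (Z n \<omega>) * path_sum (Z n \<omega>) t g) \<partial>\<Omega>) \<le> ennreal (?m B * path_sum B t g)"
      using Suc.prems Suc by (intro Suc.IH) force+
    then show ?thesis by (simp add: Suc)
  qed simp
  have down: "(\<integral>\<^sup>+\<omega>. ennreal (?m (Z n \<omega>) * (Z n \<omega> (Suc h) * path_sum (Z n \<omega>) t (Suc h))) \<partial>\<Omega>) \<le>
      ennreal (?m B * (B (Suc h) * path_sum B t (Suc h)))"
  proof (cases "t < Suc h")
    case False
    let ?p = "p(Suc h := Suc (p (Suc h)))"
    have h: "Suc h \<in> {1..j}" "Suc h \<in> {1..n}" using False Suc.prems(3) n by auto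
    have m: "(\<Prod>i=1..n. z i ^ ?p i) = ?m z * z (Suc h)" for z :: "nat \<Rightarrow> real"
    proof -
      have "(\<Prod>i=1..n. z i ^ ?p i) = z (Suc h) ^ Suc (p (Suc h)) * (\<Prod>i\<in>{1..n} - {Suc h}. z i ^ ?p i)"
        using h by (subst prod.remove[of _ "Suc h"]) auto
      also have "(\<Prod>i\<in>{1..n} - {Suc h}. z i ^ ?p i) = (\<Prod>i\<in>{1..n} - {Suc h}. z i ^ p i)"
        by (intro prod.cong) auto
      also have "z (Suc h) ^ Suc (p (Suc h)) * \<dots> = ?m z * z (Suc h)"
        using h by (subst (2) prod.remove[of _ "Suc h"]) auto
      finally show ?thesis .
    qed
    have "(\<integral>\<^sup>+\<omega>. ennreal ((\<Prod>i=1..n. Z n \<omega> i ^ ?p i) * path_sum (Z n \<omega>) t (Suc h)) \<partial>\<Omega>) \<le>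
        ennreal ((\<Prod>i=1..n. B i ^ ?p i) * path_sum B t (Suc h))"
    proof (rule Suc.IH)
      fix i
      show "i \<notin> {1..j} \<Longrightarrow> ?p i = 0" using Suc.prems(1)[of i] h by auto
      show "i \<in> {1..j} \<Longrightarrow> 2 * ?p i + t \<le> 2 * j + Suc h" using Suc.prems(2)[of i] by auto
      show "t + Suc h \<le> 2 * j" using Suc.prems(3) by simp
    qed
    then show ?thesis unfolding m by (simp only: mult.assoc)
  qed (simp add: path_sum_above)
  have meas: "(\<lambda>\<omega>. path_sum (Z n \<omega>) t g) \<in> borel_measurable \<Omega>" for g
    by (intro measurable_path_sum) simp
  have "(\<integral>\<^sup>+\<omega>. ennreal (?m (Z n \<omega>) * path_sum (Z n \<omega>) (Suc t) h) \<partial>\<Omega>) =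
      (\<integral>\<^sup>+\<omega>. ennreal (?m (Z n \<omega>) * (case h of 0 \<Rightarrow> 0 | Suc g \<Rightarrow> path_sum (Z n \<omega>) t g)) +
        ennreal (?m (Z n \<omega>) * (Z n \<omega> (Suc h) * path_sum (Z n \<omega>) t (Suc h))) \<partial>\<Omega>)"
  proof (rule nn_integral_cong_AE)
    show "AE \<omega> in \<Omega>. ennreal (?m (Z n \<omega>) * path_sum (Z n \<omega>) (Suc t) h) =
        ennreal (?m (Z n \<omega>) * (case h of 0 \<Rightarrow> 0 | Suc g \<Rightarrow> path_sum (Z n \<omega>) t g)) +
        ennreal (?m (Z n \<omega>) * (Z n \<omega> (Suc h) * path_sum (Z n \<omega>) t (Suc h)))"
      using nonneg
    proof eventually_elim
      case (elim \<omega>)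
      then show ?case
        by (subst ennreal_plus[symmetric])
          (auto intro!: mult_nonneg_nonneg prod_nonneg path_sum_nonneg split: nat.splits simp: distrib_left)
    qed
  qed
  also have "\<dots> = (\<integral>\<^sup>+\<omega>. ennreal (?m (Z n \<omega>) * (case h of 0 \<Rightarrow> 0 | Suc g \<Rightarrow> path_sum (Z n \<omega>) t g)) \<partial>\<Omega>) +
      (\<integral>\<^sup>+\<omega>. ennreal (?m (Z n \<omega>) * (Z n \<omega> (Suc h) * path_sum (Z n \<omega>) t (Suc h))) \<partial>\<Omega>)"
    using meas by (intro nn_integral_add) (cases h; simp; measurable)+
  also have "\<dots> \<le> ennreal (?m B * (case h of 0 \<Rightarrow> 0 | Suc g \<Rightarrow> path_sum B t g)) +
      ennreal (?m B * (B (Suc h) * path_sum B t (Suc h)))"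
    by (intro add_mono up down)
  also have "\<dots> = ennreal (?m B * path_sum B (Suc t) h)"
    using B by (subst ennreal_plus[symmetric])
      (auto intro!: mult_nonneg_nonneg prod_nonneg path_sum_nonneg split: nat.splits simp: distrib_left)
  finally show ?case .
qed

lemma mean_moment_le:
  assumes B: "\<And>i. B i \<ge> 0" and j: "1 \<le> j" "j \<le> n"
    and mean: "\<And>i p. i \<in> {1..j} \<Longrightarrow> p \<le> j \<Longrightarrow> coordinate_mean n i (\<lambda>t. ennreal (t ^ p)) \<le> ennreal (B i ^ p)"
  shows "(\<integral>\<^sup>+\<omega>. ennreal \<bar>X n j \<omega>\<bar> \<partial>\<Omega>) \<le> ennreal (moment_of_canonical B j)"
proof -
  have "(\<integral>\<^sup>+\<omega>. ennreal \<bar>X n j \<omega>\<bar> \<partial>\<Omega>) =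
      (\<integral>\<^sup>+\<omega>. ennreal ((\<Prod>i=1..n. Z n \<omega> i ^ 0) * path_sum (Z n \<omega>) (2 * j) 0) \<partial>\<Omega>)"
  proof (rule nn_integral_cong_AE)
    have "1 \<le> n" using j by simp
    from AE_moments[OF this] show "AE \<omega> in \<Omega>. ennreal \<bar>X n j \<omega>\<bar> =
        ennreal ((\<Prod>i=1..n. Z n \<omega> i ^ 0) * path_sum (Z n \<omega>) (2 * j) 0)"
    proof eventually_elim
      case (elim \<omega>)
      then have "path_sum (Z n \<omega>) (2 * j) 0 \<ge> 0" by (intro path_sum_nonneg) (simp add: less_imp_le)
      then show ?case using elim j by (simp add: moment_of_canonical_def)
    qed
  qed
  also have "\<dots> \<le> ennreal ((\<Prod>i=1..n. B i ^ 0) * path_sum B (2 * j) 0)"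
    using j B mean by (intro mean_path_sum_le[where j = j]) auto
  finally show ?thesis by (simp add: moment_of_canonical_def)
qed

text \<open>Only powers of \<open>z\<^sub>i\<close> up to \<open>j \<le> n\<close> occur, and those have finite expectation.  One bound \<open>B\<^sub>i\<close> serves for all
  of them because \<open>B\<^sub>i \<ge> 1\<close>.\<close>

lemma X_integrable:
  assumes j: "1 \<le> j" "j \<le> n"
  shows "integrable \<Omega> (X n j)"
proof (rule integrableI_bounded)
  show "X n j \<in> borel_measurable \<Omega>" using j by (rule X_measurable)
  define c where "c i p = enn2real (coordinate_mean n i (\<lambda>t. ennreal (t ^ p)))" for i p
  define B where "B i = 1 + (\<Sum>p\<le>j. c i p)" for i
  have c: "c i p \<ge> 0" for i p by (simp add: c_def)
  have B: "B i \<ge> 1" for i using c by (simp add: B_def sum_nonneg)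
  have "(\<integral>\<^sup>+\<omega>. ennreal \<bar>X n j \<omega>\<bar> \<partial>\<Omega>) \<le> ennreal (moment_of_canonical B j)"
  proof (rule mean_moment_le[OF _ j])
    show "B i \<ge> 0" for i using B[of i] by simp
    fix i p assume i: "i \<in> {1..j}" and p: "p \<le> j"
    then have i': "1 \<le> i" "i \<le> n" using j by auto
    show "coordinate_mean n i (\<lambda>t. ennreal (t ^ p)) \<le> ennreal (B i ^ p)"
    proof (cases "p = 0")
      case True
      then show ?thesis using i' by (simp add: coordinate_mean_one)
    next
      case False
      obtain a where a: "a > 0" "J n i (\<lambda>_. 1) = ennreal a" using J_one[OF i'] by metis
      have "J n i (\<lambda>t. ennreal (t ^ p)) < \<infinity>"
        using p j by (intro canonical_weight_integral_finite[OF \<epsilon> V_admissible i']) auto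
      then have "coordinate_mean n i (\<lambda>t. ennreal (t ^ p)) < \<infinity>"
        using a by (simp add: coordinate_mean_def inverse_ennreal ennreal_mult_less_top)
      then have "coordinate_mean n i (\<lambda>t. ennreal (t ^ p)) = ennreal (c i p)"
        by (simp add: c_def)
      moreover have "c i p \<le> B i"
        unfolding B_def using p c member_le_sum[of p "{..j}" "c i"] by (simp add: add_increasing)
      moreover have "B i \<le> B i ^ p" using False B by (intro self_le_power) auto
      ultimately show ?thesis by (simp add: ennreal_leI)
    qed
  qed
  then show "(\<integral>\<^sup>+\<omega>. ennreal (norm (X n j \<omega>)) \<partial>\<Omega>) < \<infinity>"
    by (simp add: le_less_trans)
qed

text \<open>Within distance \<open>\<kappa>/2\<close> of the minimizer the power is bounded directly, and the rest is exponentially small.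
  It fits into the gap between the \<open>p\<close>-th powers for \<open>\<kappa>/2\<close> and \<open>\<kappa>\<close>.\<close>

lemma coordinate_mean_power_le:
  assumes \<kappa>: "\<kappa> > 0" and i: "1 \<le> i"
  shows "\<forall>\<^sub>F n in sequentially. coordinate_mean n i (\<lambda>t. ennreal (t ^ p)) \<le> ennreal ((minimizer i + \<kappa>) ^ p)"
proof (cases "p = 0")
  case True
  then show ?thesis using i by (auto simp: coordinate_mean_one intro!: eventually_sequentiallyI[of i])
next
  case False
  let ?s = "minimizer i"
  have s: "?s > 0" by (rule minimizer_pos)
  have \<kappa>2: "\<kappa> / 2 > 0" using \<kappa> by simp
  obtain C \<eta> n0 where C: "C \<ge> 0" "\<eta> > 0" "n0 \<ge> i" "\<And>n. n \<ge> n0 \<Longrightarrow>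
      coordinate_mean n i (\<lambda>t. ennreal (t ^ p) * indicator {t. \<bar>t - ?s\<bar> \<ge> \<kappa> / 2} t)
       \<le> ennreal (C * exp (- \<eta> * real n))"
    by (rule coordinate_mean_concentration[OF \<kappa>2 i, where p = p]) (rule that; blast)
  have "(\<lambda>n. C * exp (- \<eta>) ^ n) \<longlonglongrightarrow> C * 0"
    using C(2) by (intro tendsto_intros LIMSEQ_realpow_zero) auto
  moreover have "(?s + \<kappa> / 2) ^ p < (?s + \<kappa>) ^ p"
    using False s \<kappa> by (intro power_strict_mono) auto
  ultimately have "\<forall>\<^sub>F n in sequentially. C * exp (- \<eta>) ^ n < (?s + \<kappa>) ^ p - (?s + \<kappa> / 2) ^ p"
    by (intro order_tendstoD(2)) auto
  then show ?thesis
    using eventually_ge_at_top[of n0]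
  proof eventually_elim
    case (elim n)
    have n: "i \<le> n" using elim C(3) by simp
    let ?f = "\<lambda>t. ennreal (t ^ p) * indicator {t. \<bar>t - ?s\<bar> \<ge> \<kappa> / 2} t"
    have "coordinate_mean n i (\<lambda>t. ennreal (t ^ p)) =
        (\<integral>\<^sup>+\<omega>. ennreal (Z n \<omega> i ^ p) \<partial>\<Omega>)"
      using i n by (subst canonical_marginal[where f = "\<lambda>t. ennreal (t ^ p)"]) auto
    also have "\<dots> \<le> (\<integral>\<^sup>+\<omega>. ennreal ((?s + \<kappa> / 2) ^ p) + ?f (Z n \<omega> i) \<partial>\<Omega>)"
    proof (rule nn_integral_mono_AE)
      have "1 \<le> n" using i n by simp
      from AE_moments[OF this]
      show "AE \<omega> in \<Omega>. ennreal (Z n \<omega> i ^ p) \<le> ennreal ((?s + \<kappa> / 2) ^ p) + ?f (Z n \<omega> i)"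
      proof eventually_elim
        case (elim \<omega>)
        then have "Z n \<omega> i \<ge> 0" by (simp add: less_imp_le)
        show ?case
        proof (cases "\<bar>Z n \<omega> i - ?s\<bar> \<ge> \<kappa> / 2")
          case False
          then have "Z n \<omega> i \<le> ?s + \<kappa> / 2" by linarith
          with \<open>Z n \<omega> i \<ge> 0\<close> False show ?thesis by (simp add: ennreal_leI power_mono)
        qed (simp add: add_increasing)
      qed
    qed
    also have "\<dots> = (\<integral>\<^sup>+\<omega>. ennreal ((?s + \<kappa> / 2) ^ p) \<partial>\<Omega>) + (\<integral>\<^sup>+\<omega>. ?f (Z n \<omega> i) \<partial>\<Omega>)"
      by (rule nn_integral_add) measurable
    also have "(\<integral>\<^sup>+\<omega>. ennreal ((?s + \<kappa> / 2) ^ p) \<partial>\<Omega>) = ennreal ((?s + \<kappa> / 2) ^ p)"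
      by (simp add: emeasure_space_1)
    also have "(\<integral>\<^sup>+\<omega>. ?f (Z n \<omega> i) \<partial>\<Omega>) = coordinate_mean n i ?f"
      by (rule canonical_marginal[where f = ?f, OF _ i n]) measurable
    also have "ennreal ((?s + \<kappa> / 2) ^ p) + coordinate_mean n i ?f \<le>
        ennreal ((?s + \<kappa> / 2) ^ p) + ennreal (C * exp (- \<eta> * real n))"
      using elim(2) by (intro add_left_mono C(4))
    also have "\<dots> = ennreal ((?s + \<kappa> / 2) ^ p + C * exp (- \<eta>) ^ n)"
      using C(1) s \<kappa> by (subst ennreal_plus) (auto simp: exp_of_nat_mult[symmetric] mult.commute)
    also have "\<dots> \<le> ennreal ((?s + \<kappa>) ^ p)" using elim(1) by (intro ennreal_leI) simp
    finally show ?case .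
  qed
qed

text \<open>By Scheffe's lemma it suffices that the expectations are asymptotically at most the almost sure limit.
  The bound by the path sum at the minimizers shifted by \<open>\<kappa>\<close> gives this as \<open>\<kappa>\<close> tends to \<open>0\<close>.\<close>

lemma moment_L1:
  assumes j: "1 \<le> j"
  shows "(\<lambda>n. \<integral>\<omega>. \<bar>X n j \<omega> - moment_of_canonical minimizer j\<bar> \<partial>\<Omega>) \<longlonglongrightarrow> 0"
proof -
  let ?m = "moment_of_canonical minimizer j"
  have m0: "?m \<ge> 0"
    unfolding moment_of_canonical_def by (intro path_sum_nonneg less_imp_le minimizer_pos)
  have ev: "\<forall>\<^sub>F n in sequentially. (\<integral>\<^sup>+\<omega>. ennreal (norm (X n j \<omega>)) \<partial>\<Omega>) \<le>
      ennreal (moment_of_canonical (\<lambda>i. minimizer i + \<kappa>) j)" if \<kappa>: "\<kappa> > 0" for \<kappa>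
  proof -
    have "\<forall>\<^sub>F n in sequentially. \<forall>i\<in>{1..j}. \<forall>p\<in>{..j}.
        coordinate_mean n i (\<lambda>t. ennreal (t ^ p)) \<le> ennreal ((minimizer i + \<kappa>) ^ p)"
      using coordinate_mean_power_le[OF \<kappa>] by (intro eventually_ball_finite ballI) auto
    then show ?thesis using eventually_ge_at_top[of j]
    proof eventually_elim
      case (elim n)
      have "minimizer i + \<kappa> \<ge> 0" for i using minimizer_pos[of i] \<kappa> by simp
      then show ?case unfolding real_norm_def using elim j by (intro mean_moment_le) auto
    qed
  qed
  have "limsup (\<lambda>n. \<integral>\<^sup>+\<omega>. ennreal (norm (X (n + j) j \<omega>)) \<partial>\<Omega>) \<le>
      ennreal (moment_of_canonical (\<lambda>i. minimizer i + inverse (real (Suc l))) j)" for l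
    by (intro Limsup_bounded eventually_sequentially_seg[THEN iffD2, OF ev]) simp
  moreover have "(\<lambda>l. ennreal (moment_of_canonical (\<lambda>i. minimizer i + inverse (real (Suc l))) j)) \<longlonglongrightarrow> ennreal ?m"
  proof (rule tendsto_ennrealI)
    have lim: "(\<lambda>l. path_sum (\<lambda>i. minimizer i + inverse (real (Suc l))) t h) \<longlonglongrightarrow> path_sum minimizer t h" for t h
    proof (induction t arbitrary: h)
      case (Suc t)
      have "(\<lambda>l. minimizer (Suc h) + inverse (real (Suc l))) \<longlonglongrightarrow> minimizer (Suc h) + 0"
        by (intro tendsto_intros LIMSEQ_inverse_real_of_nat)
      then show ?case using Suc by (cases h) (auto intro!: tendsto_intros)
    qed simp
    then show "(\<lambda>l. moment_of_canonical (\<lambda>i. minimizer i + inverse (real (Suc l))) j) \<longlonglongrightarrow> ?m"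
      unfolding moment_of_canonical_def .
  qed
  ultimately have limsup: "limsup (\<lambda>n. \<integral>\<^sup>+\<omega>. ennreal (norm (X (n + j) j \<omega>)) \<partial>\<Omega>) \<le> ennreal ?m"
    by (intro tendsto_lowerbound[of _ "ennreal ?m" sequentially]) auto
  have "(\<lambda>n. \<integral>\<^sup>+\<omega>. ennreal (norm (X (n + j) j \<omega> - ?m)) \<partial>\<Omega>) \<longlonglongrightarrow> 0"
  proof (rule Scheffe_lemma1)
    show "integrable \<Omega> (X (n + j) j)" for n using j by (intro X_integrable) auto
    show "AE \<omega> in \<Omega>. (\<lambda>n. X (n + j) j \<omega>) \<longlonglongrightarrow> ?m"
      using AE_X_tendsto by eventually_elim (use j in \<open>auto intro!: LIMSEQ_ignore_initial_segment\<close>)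
    show "limsup (\<lambda>n. \<integral>\<^sup>+\<omega>. ennreal (norm (X (n + j) j \<omega>)) \<partial>\<Omega>) \<le> (\<integral>\<^sup>+\<omega>. ennreal (norm ?m) \<partial>\<Omega>)"
      using limsup m0 by (simp add: emeasure_space_1)
  qed simp
  then have "(\<lambda>n. ennreal (\<integral>\<omega>. \<bar>X (n + j) j \<omega> - ?m\<bar> \<partial>\<Omega>)) \<longlonglongrightarrow> ennreal 0"
    using j X_integrable
    by (subst (asm) nn_integral_eq_integral) auto
  then have "(\<lambda>n. \<integral>\<omega>. \<bar>X (n + j) j \<omega> - ?m\<bar> \<partial>\<Omega>) \<longlonglongrightarrow> 0"
    by (subst (asm) tendsto_ennreal_iff) auto
  then show ?thesis by (rule LIMSEQ_offset)
qed

lemma moment_limit: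
  "1 \<le> j \<Longrightarrow> moment (marchenko_pastur z1 z2) j = moment_of_canonical minimizer j"
proof -
  assume j: "1 \<le> j"
  have "z1 > 0" "z2 > 0" using minimizer_pos[of 1] minimizer_pos[of 2] by (simp_all add: minimizer_def)
  from moment_marchenko_pastur[OF this j] show ?thesis
    using moment_of_canonical_periodic[of minimizer z1 z2 j] j by (simp add: minimizer_def)
qed

end

theorem theorem2p5:
  fixes V1 V2 :: "real \<Rightarrow> real" and \<epsilon> z1 z2 :: real
    and \<Omega> :: "'a measure" and X :: "nat \<Rightarrow> nat \<Rightarrow> 'a \<Rightarrow> real" and k :: nat
  assumes "\<epsilon> > 0"
    and "admissible_potential \<epsilon> V1" and "admissible_potential \<epsilon> V2"
    and "unique_minimizer_on (\<lambda>z. V1 z - ln z) {0<..} z1"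
    and "unique_minimizer_on (\<lambda>z. V2 z - ln z) {0<..} z2"
    and "prob_space \<Omega>"
    and "\<And>n j. 1 \<le> j \<Longrightarrow> j \<le> n \<Longrightarrow> X n j \<in> borel_measurable \<Omega>"
    and "\<And>n. 1 \<le> n \<Longrightarrow>
      distr \<Omega> (lebesgue_prod n) (\<lambda>\<omega>. \<lambda>j\<in>{1..n}. X n j \<omega>) = moment_law V1 V2 n"
    and "1 \<le> k"
  shows "(AE \<omega> in \<Omega>.
      (\<lambda>n. coord_dist k (\<lambda>j. X n j \<omega>) (moment (marchenko_pastur z1 z2))) \<longlonglongrightarrow> 0) \<and>
    (\<forall>n\<ge>k. \<forall>j\<in>{1..k}. integrable \<Omega> (X n j)) \<and>
    (\<lambda>n. \<integral>\<omega>. coord_dist k (\<lambda>j. X n j \<omega>) (moment (marchenko_pastur z1 z2)) \<partial>\<Omega>)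
      \<longlonglongrightarrow> 0 \<and>
    (\<forall>j\<in>{1..k}. moment (marchenko_pastur z1 z2) j =
      (\<Sum>i=0..(j - 1) div 2. real ((j - 1) choose (2 * i)) * z1 ^ (i + 1) * z2 ^ i *
         (z1 + z2) ^ (j - 1 - 2 * i) * (1 / real (i + 1)) * real ((2 * i) choose i)))"
proof -
  interpret random_moments \<Omega> V1 V2 \<epsilon> z1 z2 X
    using assms(1-8) by (simp add: random_moments_def random_moments_axioms_def)
  let ?y = "moment (marchenko_pastur z1 z2)"
  have pos: "z1 > 0" "z2 > 0"
    using minimizer_pos[of 1] minimizer_pos[of 2] by (simp_all add: minimizer_def)
  have as: "AE \<omega> in \<Omega>. (\<lambda>n. coord_dist k (\<lambda>j. X n j \<omega>) ?y) \<longlonglongrightarrow> 0"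
    using AE_X_tendsto
  proof eventually_elim
    case (elim \<omega>)
    have "(\<lambda>n. coord_dist k (\<lambda>j. X n j \<omega>) ?y) \<longlonglongrightarrow> sqrt (\<Sum>j=1..k. (?y j - ?y j)\<^sup>2)"
      unfolding coord_dist_def L2_set_def
      using elim by (intro tendsto_intros) (auto simp: moment_limit)
    then show ?case by simp
  qed
  have "(\<lambda>n. \<integral>\<omega>. coord_dist k (\<lambda>j. X n j \<omega>) ?y \<partial>\<Omega>) \<longlonglongrightarrow> 0"
  proof (rule tendsto_sandwich)
    show "\<forall>\<^sub>F n in sequentially. 0 \<le> (\<integral>\<omega>. coord_dist k (\<lambda>j. X n j \<omega>) ?y \<partial>\<Omega>)"
      by (intro always_eventually allI integral_nonneg_AE) (simp add: coord_dist_def)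
    show "\<forall>\<^sub>F n in sequentially. (\<integral>\<omega>. coord_dist k (\<lambda>j. X n j \<omega>) ?y \<partial>\<Omega>) \<le>
        (\<Sum>j=1..k. \<integral>\<omega>. \<bar>X n j \<omega> - ?y j\<bar> \<partial>\<Omega>)"
    proof (rule eventually_sequentiallyI[of k])
      fix n assume n: "k \<le> n"
      have int: "integrable \<Omega> (\<lambda>\<omega>. \<bar>X n j \<omega> - ?y j\<bar>)" if "j \<in> {1..k}" for j
        using X_integrable[of j n] that n by simp
      have le: "coord_dist k (\<lambda>j. X n j \<omega>) ?y \<le> (\<Sum>j=1..k. \<bar>X n j \<omega> - ?y j\<bar>)" for \<omega>
        unfolding coord_dist_def by (rule L2_set_le_sum_abs)
      have meas: "(\<lambda>\<omega>. coord_dist k (\<lambda>j. X n j \<omega>) ?y) \<in> borel_measurable \<Omega>"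
        unfolding coord_dist_def L2_set_def using X_measurable n
        by (intro measurable_compose[OF _ borel_measurable_sqrt] borel_measurable_sum
            borel_measurable_power borel_measurable_diff) auto
      have sum: "integrable \<Omega> (\<lambda>\<omega>. \<Sum>j=1..k. \<bar>X n j \<omega> - ?y j\<bar>)"
        using int by (rule Bochner_Integration.integrable_sum)
      from sum meas have "integrable \<Omega> (\<lambda>\<omega>. coord_dist k (\<lambda>j. X n j \<omega>) ?y)"
      proof (rule Bochner_Integration.integrable_bound)
        show "AE \<omega> in \<Omega>. norm (coord_dist k (\<lambda>j. X n j \<omega>) ?y) \<le> norm (\<Sum>j=1..k. \<bar>X n j \<omega> - ?y j\<bar>)"
        proof (rule AE_I2)
          fix \<omega>
          have "0 \<le> coord_dist k (\<lambda>j. X n j \<omega>) ?y" by (simp add: coord_dist_def)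
          then show "norm (coord_dist k (\<lambda>j. X n j \<omega>) ?y) \<le> norm (\<Sum>j=1..k. \<bar>X n j \<omega> - ?y j\<bar>)"
            using le[of \<omega>] by simp
        qed
      qed
      then have "(\<integral>\<omega>. coord_dist k (\<lambda>j. X n j \<omega>) ?y \<partial>\<Omega>) \<le> (\<integral>\<omega>. (\<Sum>j=1..k. \<bar>X n j \<omega> - ?y j\<bar>) \<partial>\<Omega>)"
        using sum le by (rule integral_mono)
      also have "\<dots> = (\<Sum>j=1..k. \<integral>\<omega>. \<bar>X n j \<omega> - ?y j\<bar> \<partial>\<Omega>)"
        using int by (rule Bochner_Integration.integral_sum)
      finally show "(\<integral>\<omega>. coord_dist k (\<lambda>j. X n j \<omega>) ?y \<partial>\<Omega>) \<le>
          (\<Sum>j=1..k. \<integral>\<omega>. \<bar>X n j \<omega> - ?y j\<bar> \<partial>\<Omega>)" .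
    qed
    have "(\<lambda>n. \<Sum>j=1..k. \<integral>\<omega>. \<bar>X n j \<omega> - ?y j\<bar> \<partial>\<Omega>) \<longlonglongrightarrow> (\<Sum>j=1..k. 0)"
      by (intro tendsto_sum) (use moment_L1 moment_limit in auto)
    then show "(\<lambda>n. \<Sum>j=1..k. \<integral>\<omega>. \<bar>X n j \<omega> - ?y j\<bar> \<partial>\<Omega>) \<longlonglongrightarrow> 0" by simp
  qed simp
  then show ?thesis
    using as X_integrable moment_marchenko_pastur[OF pos] by auto
qed

end
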